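(* Let $K\subset\mathbb{R}^3$ be a PL knot with indicatrix $I\subset S^2$, and let $\mathcal{O}_K\subset S^2$ be the set of directions of good projections of $K$. If $\xi,\xi'\in\mathcal{O}_K$ belong to the same connected component of $S^2\setminus I$, then $T_K(\xi)=T_K(\xi')$.
   Context: A PL knot $K$ is a union of finitely many segments in $\mathbb{R}^3$, homeomorphic to $S^1$. Fix such a decomposition into segments (consecutive segments share an endpoint and distinct segments meet at most in common endpoints). The endpoints of the segments are the vertices of $K$; all other points of $K$ are interior points. Good projections: for $\xi\in S^2$ let $p_\xi\colon K\to\mathbb{R}^2$ be the orthogonal projection along the line $\mathbb{R}\xi$ (onto the plane $\xi^\perp\cong\mathbb{R}^2$). It is a good projection if for every $v\in\mathbb{R}^2$ the set $p_\xi^{-1}(v)$ is empty, one point, or two interior points of $K$. $\mathcal{O}_K$ denotes the set of $\xi\in S^2$ such that $p_\xi$ is a good projection. Tait number: let $\xi\in\mathcal{O}_K$ and orient $K$. At a double point $v$, the upper strand is the one through the preimage of $v$ with larger inner product with $\xi$. The plane $\xi^\perp$ is oriented as seen from the side to which $\xi$ points (an ordered basis $(e_1,e_2)$ is positive iff $(e_1,e_2,\xi)$ is positive in $\mathbb{R}^3$). Put $s(v)=+1$ if the oriented upper strand has to be turned counterclockwise (by an angle less than $\pi$) to coincide with the oriented lower strand, and $s(v)=-1$ otherwise; this is independent of the orientation of $K$. The Tait number is $T_K(\xi)=\sum_v s(v)$, the sum over all double points. Indicatrix: orient $K$ and number its segments cyclically $S_1,\dots,S_n$; let $s_i\in S^2$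 be the unit direction of the oriented segment $S_i$. Let $\Gamma_i$ be the (shorter) oriented arc of great circle from $s_i$ to $s_{i+1}$ (indices mod $n$; a single point if $s_i=s_{i+1}$; $s_{i+1}\ne -s_i$ since $K$ is embedded), and $\Gamma=\bigcup_{i=1}^n\Gamma_i$. The indicatrix is $I=\Gamma\cup(-\Gamma)$, where $-\Gamma$ is the antipodal curve. *)

theory Defs
  imports "HOL-Analysis.Analysis"
begin

definition PL_knot :: "(real^3) set \<Rightarrow> bool" where
  "PL_knot K \<longleftrightarrow>
     (\<exists>F. finite F \<and> (\<forall>S\<in>F. \<exists>a b. a \<noteq> b \<and> S = closed_segment a b) \<and> K = \<Union>F) \<and>
     K homeomorphic sphere (0::real^2) 1"

text \<open>
  A decomposition into segments, numbered cyclically, is given by its vertices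
  \<open>p 0, \<dots>, p (n - 1)\<close>; the values \<open>p i\<close> with \<open>i \<ge> n\<close> are irrelevant. The numbering
  also orients the knot, from \<open>p i\<close> towards the next vertex.
\<close>

definition segment :: "nat \<Rightarrow> (nat \<Rightarrow> real^3) \<Rightarrow> nat \<Rightarrow> (real^3) set" where
  "segment n p i = closed_segment (p i) (p (Suc i mod n))"

definition segment_ends :: "nat \<Rightarrow> (nat \<Rightarrow> real^3) \<Rightarrow> nat \<Rightarrow> (real^3) set" where
  "segment_ends n p i = {p i, p (Suc i mod n)}"

text \<open>
  For a knot, the circle topology together with these conditions forces \<open>n \<ge> 3\<close> and
  pairwise distinct vertices.
\<close>

definition decomposition :: "(real^3) set \<Rightarrow> nat \<Rightarrow> (nat \<Rightarrow> real^3) \<Rightarrow> bool" where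
  "decomposition K n p \<longleftrightarrow>
     K = (\<Union>i<n. segment n p i) \<and>
     (\<forall>i<n. p i \<noteq> p (Suc i mod n)) \<and>
     (\<forall>i<n. \<forall>j<n. i \<noteq> j \<longrightarrow>
        segment n p i \<inter> segment n p j \<subseteq> segment_ends n p i \<inter> segment_ends n p j)"

definition vertices :: "nat \<Rightarrow> (nat \<Rightarrow> real^3) \<Rightarrow> (real^3) set" where
  "vertices n p = p ` {..<n}"

definition interior_points :: "(real^3) set \<Rightarrow> nat \<Rightarrow> (nat \<Rightarrow> real^3) \<Rightarrow> (real^3) set" where
  "interior_points K n p = K - vertices n p"

text \<open>
  Orthogonal projection along the line \<open>\<real>\<xi>\<close> (\<open>\<xi>\<close> a unit vector) onto the plane \<open>\<xi>\<^sup>\<bottom>\<close>,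
  which is kept as a subspace of \<open>\<real>\<^sup>3\<close>.
\<close>

definition orth_plane :: "real^3 \<Rightarrow> (real^3) set" where
  "orth_plane \<xi> = {v. v \<bullet> \<xi> = 0}"

definition orth_proj :: "real^3 \<Rightarrow> real^3 \<Rightarrow> real^3" where
  "orth_proj \<xi> x = x - (x \<bullet> \<xi>) *\<^sub>R \<xi>"

definition fibre :: "(real^3) set \<Rightarrow> real^3 \<Rightarrow> real^3 \<Rightarrow> (real^3) set" where
  "fibre K \<xi> v = {x \<in> K. orth_proj \<xi> x = v}"

definition good_projection :: "(real^3) set \<Rightarrow> nat \<Rightarrow> (nat \<Rightarrow> real^3) \<Rightarrow> real^3 \<Rightarrow> bool" where
  "good_projection K n p \<xi> \<longleftrightarrow>
     (\<forall>v\<in>orth_plane \<xi>.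
        fibre K \<xi> v = {} \<or>
        (\<exists>x. fibre K \<xi> v = {x}) \<or>
        (\<exists>x y. x \<noteq> y \<and> x \<in> interior_points K n p \<and> y \<in> interior_points K n p \<and>
               fibre K \<xi> v = {x, y}))"

definition good_directions :: "(real^3) set \<Rightarrow> nat \<Rightarrow> (nat \<Rightarrow> real^3) \<Rightarrow> (real^3) set" where
  "good_directions K n p = {\<xi> \<in> sphere 0 1. good_projection K n p \<xi>}"

definition double_points :: "(real^3) set \<Rightarrow> real^3 \<Rightarrow> (real^3) set" where
  "double_points K \<xi> = {v \<in> orth_plane \<xi>. card (fibre K \<xi> v) = 2}"

definition segment_dir :: "nat \<Rightarrow> (nat \<Rightarrow> real^3) \<Rightarrow> nat \<Rightarrow> real^3" where
  "segment_dir n p i = sgn (p (Suc i mod n) - p i)"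

text \<open>An interior point of a knot lies on exactly one segment.\<close>

definition strand_dir :: "nat \<Rightarrow> (nat \<Rightarrow> real^3) \<Rightarrow> real^3 \<Rightarrow> real^3" where
  "strand_dir n p x = segment_dir n p (THE i. i < n \<and> x \<in> segment n p i)"

definition upper_point :: "(real^3) set \<Rightarrow> real^3 \<Rightarrow> real^3 \<Rightarrow> real^3" where
  "upper_point K \<xi> v =
     (THE x. x \<in> fibre K \<xi> v \<and> (\<forall>y\<in>fibre K \<xi> v. y \<noteq> x \<longrightarrow> y \<bullet> \<xi> < x \<bullet> \<xi>))"

definition lower_point :: "(real^3) set \<Rightarrow> real^3 \<Rightarrow> real^3 \<Rightarrow> real^3" where
  "lower_point K \<xi> v =
     (THE x. x \<in> fibre K \<xi> v \<and> (\<forall>y\<in>fibre K \<xi> v. y \<noteq> x \<longrightarrow> x \<bullet> \<xi> < y \<bullet> \<xi>))"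

text \<open>
  Counterclockwise rotation by \<open>\<theta>\<close> in \<open>\<xi>\<^sup>\<bottom>\<close>, the plane being seen from the side to which
  the unit vector \<open>\<xi>\<close> points.
\<close>

definition rotate_ccw :: "real^3 \<Rightarrow> real \<Rightarrow> real^3 \<Rightarrow> real^3" where
  "rotate_ccw \<xi> \<theta> u = cos \<theta> *\<^sub>R u + sin \<theta> *\<^sub>R cross3 \<xi> u"

lemma rotate_ccw_positive:
  assumes "norm \<xi> = 1" "u \<in> orth_plane \<xi>" "u \<noteq> 0"
  shows "det (vector [u, rotate_ccw \<xi> (pi / 2) u, \<xi>]) > 0"
proof -
  have "\<xi> \<bullet> \<xi> = 1"
    using assms(1) by (simp add: dot_square_norm)
  moreover have "\<xi> \<bullet> u = 0"
    using assms(2) by (simp add: orth_plane_def inner_commute)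
  moreover have "cross3 (cross3 \<xi> u) \<xi> = (\<xi> \<bullet> \<xi>) *\<^sub>R u - (\<xi> \<bullet> u) *\<^sub>R \<xi>"
    by (simp add: cross3_simps forall_3)
  ultimately have "det (vector [u, rotate_ccw \<xi> (pi / 2) u, \<xi>]) = u \<bullet> u"
    by (simp add: rotate_ccw_def flip: dot_cross_det)
  then show ?thesis
    using assms(3) by simp
qed

definition crossing_sign ::
  "(real^3) set \<Rightarrow> nat \<Rightarrow> (nat \<Rightarrow> real^3) \<Rightarrow> real^3 \<Rightarrow> real^3 \<Rightarrow> int" where
  "crossing_sign K n p \<xi> v =
     (let u = orth_proj \<xi> (strand_dir n p (upper_point K \<xi> v));
          w = orth_proj \<xi> (strand_dir n p (lower_point K \<xi> v))
      in if \<exists>\<theta>. 0 < \<theta> \<and> \<theta> < pi \<and> (\<exists>c>0. w = c *\<^sub>R rotate_ccw \<xi> \<theta> u) then 1 else - 1)"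

text \<open>For a good projection there are only finitely many double points.\<close>

definition tait_number :: "(real^3) set \<Rightarrow> nat \<Rightarrow> (nat \<Rightarrow> real^3) \<Rightarrow> real^3 \<Rightarrow> int" where
  "tait_number K n p \<xi> = (\<Sum>v\<in>double_points K \<xi>. crossing_sign K n p \<xi> v)"

text \<open>
  For unit vectors \<open>a \<noteq> - b\<close>, the shorter great circle arc from \<open>a\<close> to \<open>b\<close> (the point \<open>a\<close>
  if \<open>a = b\<close>), as the part of the unit sphere in the convex cone spanned by \<open>a\<close> and \<open>b\<close>.
\<close>

definition great_arc :: "real^3 \<Rightarrow> real^3 \<Rightarrow> (real^3) set" where
  "great_arc a b = {x \<in> sphere 0 1. \<exists>\<alpha>\<ge>0. \<exists>\<beta>\<ge>0. x = \<alpha> *\<^sub>R a + \<beta> *\<^sub>R b}"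

definition indicatrix_curve :: "nat \<Rightarrow> (nat \<Rightarrow> real^3) \<Rightarrow> (real^3) set" where
  "indicatrix_curve n p =
     (\<Union>i<n. great_arc (segment_dir n p i) (segment_dir n p (Suc i mod n)))"

definition indicatrix :: "nat \<Rightarrow> (nat \<Rightarrow> real^3) \<Rightarrow> (real^3) set" where
  "indicatrix n p = indicatrix_curve n p \<union> uminus ` indicatrix_curve n p"

end

theory Submission
  imports Defs
begin

text \<open>
  The sign of a crossing is a property of the two segments in space, independent of the
  direction of projection: with edge vectors \<open>e\<^sub>i\<close> it is the sign of
  \<open>(p i - p j) \<bullet> (e\<^sub>i \<times> e\<^sub>j)\<close>. And segment \<open>i\<close> crosses over segment \<open>j\<close>, seen along \<open>\<xi>\<close>, if and only
  if \<open>\<xi>\<close> lies in the cone over the parallelogram of the differences \<open>x - y\<close> with \<open>x\<close> in segment \<open>i\<close> and \<open>y\<close> in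
  segment \<open>j\<close>. So the Tait number is the sum, over all ordered pairs of segments, of
  the signed indicator functions of spherical quadrilaterals, evaluated at \<open>\<xi>\<close>
  (\<open>tait_number_eq_signed_crossings\<close>).

  When \<open>\<xi>\<close> moves along an arc, the indicator of a quadrilateral changes by the signed number of
  times the arc crosses its boundary (\<open>parallelogram_flux\<close>). The boundary consists of
  four arcs, one for each pair of a segment and an end of the other. The arc of a vertex \<open>p k\<close> and a segment
  occurs twice with opposite orientations, for the two segments that meet at \<open>p k\<close>, and the total
  change telescopes to zero (\<open>perimeter_flux_telescopes\<close>). The exception is a pair of
  adjacent segments, which have no crossing to change. Their
  quadrilateral degenerates to an arc of the indicatrix or of its antipode. As long as the path avoids
  these arcs, the cancellation is complete (\<open>crossings_change\<close>).

  The arcs used have to be generic, and the component may contain directions in which the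
  projection is not good. The sum of indicators is defined in all directions and is
  invariant as long as both ends of an arc are directions in which no vertex is covered by
  another point. Such directions are the complement of finitely many arcs, hence dense, and
  the sum is locally constant on them near every point off the indicatrix
  (\<open>signed_crossings_locally_constant\<close>). Connectedness then gives the theorem.

  That \<open>K\<close> is a circle and not merely a closed polygon is used to see that the vertices are distinct
  (\<open>knot_vertices_distinct\<close>), so that segments which are not adjacent are disjoint.
\<close>

section \<open>Segments in the plane and the first quadrant\<close>

lemma quadrant_crossing_ccw:
  fixes a1 b1 a2 b2 :: real
  assumes D: "0 < a1 * b2 - a2 * b1"
    and ax: "\<not> (b1 = 0 \<and> 0 < a1)" "\<not> (b2 = 0 \<and> 0 < a2)"
            "\<not> (a1 = 0 \<and> 0 < b1)" "\<not> (a2 = 0 \<and> 0 < b2)"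
  shows "(\<exists>r\<in>{0..1}. (1 - r) * b1 + r * b2 = 0 \<and> 0 < (1 - r) * a1 + r * a2) \<longleftrightarrow> b1 < 0 \<and> 0 < b2"
    and "(\<exists>r\<in>{0..1}. (1 - r) * a1 + r * a2 = 0 \<and> 0 < (1 - r) * b1 + r * b2) \<longleftrightarrow> a2 < 0 \<and> 0 < a1"
proof -
  have main: "(\<exists>r\<in>{0..1}. (1 - r) * b + r * b' = 0 \<and> 0 < (1 - r) * a + r * a') \<longleftrightarrow> b < 0 \<and> 0 < b'"
    if D: "0 < a * b' - a' * b" and ax: "\<not> (b = 0 \<and> 0 < a)" "\<not> (b' = 0 \<and> 0 < a')"
    for a b a' b' :: real
  proof
    assume "\<exists>r\<in>{0..1}. (1 - r) * b + r * b' = 0 \<and> 0 < (1 - r) * a + r * a'"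
    then obtain r where r: "0 \<le> r" "r \<le> 1" "(1 - r) * b + r * b' = 0" "0 < (1 - r) * a + r * a'"
      by auto
    have r01: "r \<noteq> 0" "r \<noteq> 1"
      using r(3,4) ax by auto
    have "((1 - r) * a + r * a') * b' = (1 - r) * (a * b' - a' * b)"
         "((1 - r) * a + r * a') * b = - (r * (a * b' - a' * b))"
      using r(3) by algebra+
    moreover have "0 < (1 - r) * (a * b' - a' * b)" "0 < r * (a * b' - a' * b)"
      using r01 r(1,2) D by auto
    ultimately show "b < 0 \<and> 0 < b'"
      using r(4) by (smt (verit) mult_nonneg_nonneg zero_less_mult_iff)
  next
    assume b: "b < 0 \<and> 0 < b'"
    define r where "r = - b / (b' - b)"
    have "0 < b' - b" using b by simp
    then have "1 - r = b' / (b' - b)"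
      by (simp add: r_def field_simps)
    then have "(1 - r) * x + r * y = (b' * x - b * y) / (b' - b)" for x y
      by (simp add: r_def diff_divide_distrib)
    moreover have "r \<in> {0..1}"
      using b \<open>0 < b' - b\<close> by (auto simp: r_def field_simps)
    ultimately have "r \<in> {0..1}" "(1 - r) * b + r * b' = 0" "(1 - r) * a + r * a' = (a * b' - a' * b) / (b' - b)"
      by (simp_all add: mult.commute)
    with D \<open>0 < b' - b\<close> show "\<exists>r\<in>{0..1}. (1 - r) * b + r * b' = 0 \<and> 0 < (1 - r) * a + r * a'"
      by (intro bexI[of _ r]) auto
  qed
  show "(\<exists>r\<in>{0..1}. (1 - r) * b1 + r * b2 = 0 \<and> 0 < (1 - r) * a1 + r * a2) \<longleftrightarrow> b1 < 0 \<and> 0 < b2"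
    using main[of a1 b2 a2 b1] D ax by blast
  have "(\<exists>r\<in>{0..1}. (1 - r) * a1 + r * a2 = 0 \<and> 0 < (1 - r) * b1 + r * b2) \<longleftrightarrow>
        (\<exists>r\<in>{0..1}. (1 - r) * a2 + r * a1 = 0 \<and> 0 < (1 - r) * b2 + r * b1)"
    by (rule bex_cong[OF refl, THEN trans, OF refl]; rule iffI; elim bexE; rule_tac x="1 - r" in bexI)
       (auto simp: algebra_simps)
  also have "\<dots> \<longleftrightarrow> a2 < 0 \<and> 0 < a1"
    using main[of b2 a1 b1 a2] D ax by (simp add: mult.commute)
  finally show "(\<exists>r\<in>{0..1}. (1 - r) * a1 + r * a2 = 0 \<and> 0 < (1 - r) * b1 + r * b2) \<longleftrightarrow> a2 < 0 \<and> 0 < a1" .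
qed

text \<open>
  A segment that turns counterclockwise about the origin can enter the open first quadrant only
  across the positive first axis and leave it only across the positive second axis, and it meets
  each of the two at most once.
\<close>

lemma quadrant_crossing_pos:
  fixes a1 b1 a2 b2 :: real
  assumes D: "0 < a1 * b2 - a2 * b1"
    and ax: "\<not> (b1 = 0 \<and> 0 < a1)" "\<not> (b2 = 0 \<and> 0 < a2)"
            "\<not> (a1 = 0 \<and> 0 < b1)" "\<not> (a2 = 0 \<and> 0 < b2)"
  shows "of_bool (b1 < 0 \<and> 0 < b2) - of_bool (a2 < 0 \<and> 0 < a1) =
         (of_bool (0 < a2 \<and> 0 < b2) - of_bool (0 < a1 \<and> 0 < b1) :: real)"
proof -
  have "\<not> (a1 * b2 \<le> 0 \<and> 0 \<le> a2 * b1)"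
    using D by linarith
  then have "\<not> ((0 \<le> a1 \<and> b2 \<le> 0 \<or> a1 \<le> 0 \<and> 0 \<le> b2) \<and> (0 \<le> a2 \<and> 0 \<le> b1 \<or> a2 \<le> 0 \<and> b1 \<le> 0))"
    by (simp add: mult_le_0_iff zero_le_mult_iff)
  then show ?thesis
    using ax unfolding of_bool_def by (smt (verit))
qed

text \<open>
  For the segment from \<open>(a1, b1)\<close> to \<open>(a2, b2)\<close> the two existential statements say that it meets the
  positive first and the positive second axis. The determinant is the direction in which it turns
  about the origin; if it vanishes, both ends lie on one ray from the origin, because the segment
  misses the origin, and then the quadrant contains both ends or none.
\<close>

lemma quadrant_crossing:
  fixes a1 b1 a2 b2 :: real
  assumes nz: "\<And>r. r \<in> {0..1} \<Longrightarrow> (1 - r) * a1 + r * a2 \<noteq> 0 \<or> (1 - r) * b1 + r * b2 \<noteq> 0"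
    and ax: "\<not> (b1 = 0 \<and> 0 < a1)" "\<not> (b2 = 0 \<and> 0 < a2)"
            "\<not> (a1 = 0 \<and> 0 < b1)" "\<not> (a2 = 0 \<and> 0 < b2)"
  shows "sgn (a1 * b2 - a2 * b1) *
      (of_bool (\<exists>r\<in>{0..1}. (1 - r) * b1 + r * b2 = 0 \<and> 0 < (1 - r) * a1 + r * a2) -
       of_bool (\<exists>r\<in>{0..1}. (1 - r) * a1 + r * a2 = 0 \<and> 0 < (1 - r) * b1 + r * b2)) =
      of_bool (0 < a2 \<and> 0 < b2) - of_bool (0 < a1 \<and> 0 < b1)"
proof -
  consider "0 < a1 * b2 - a2 * b1" | "0 < a2 * b1 - a1 * b2" | "a1 * b2 = a2 * b1" by linarith
  then show ?thesis
  proof cases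
    case 1
    then show ?thesis
      using quadrant_crossing_ccw[OF 1 ax] quadrant_crossing_pos[OF 1 ax] by simp
  next
    case 2
    have flip: "(\<exists>r\<in>{0..1}. (1 - r) * x + r * y = 0 \<and> 0 < (1 - r) * z + r * w) \<longleftrightarrow>
        (\<exists>r\<in>{0..1}. (1 - r) * y + r * x = 0 \<and> 0 < (1 - r) * w + r * z)" for x y z w :: real
      by (rule iffI; elim bexE; rule_tac x="1 - r" in bexI) (auto simp: algebra_simps)
    show ?thesis
      using quadrant_crossing_ccw[OF 2 ax(2,1,4,3)] quadrant_crossing_pos[OF 2 ax(2,1,4,3)] 2
      by (simp add: flip[of b1 b2 a1 a2] flip[of a1 a2 b1 b2])
  next
    case 3
    \<comment> \<open>The two points lie on one line through the origin, and not on opposite sides of it.\<close>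
    have "(0 < a1 \<and> 0 < b1) \<longleftrightarrow> (0 < a2 \<and> 0 < b2)"
    proof (rule ccontr)
      assume neq: "\<not> ?thesis"
      have "a1 \<noteq> 0 \<or> b1 \<noteq> 0" "a2 \<noteq> 0 \<or> b2 \<noteq> 0" using nz[of 0] nz[of 1] by auto
      \<comment> \<open>Otherwise the points are opposite, and the point of the segment that divides it in the ratio of
          their distances from the origin, in the sum norm, is the origin.\<close>
      define N where "N = \<bar>a1\<bar> + \<bar>b1\<bar> + \<bar>a2\<bar> + \<bar>b2\<bar>"
      define r where "r = (\<bar>a1\<bar> + \<bar>b1\<bar>) / N"
      have N: "0 < N" using \<open>a1 \<noteq> 0 \<or> b1 \<noteq> 0\<close> by (auto simp: N_def)
      have opp: "(\<bar>a2\<bar> + \<bar>b2\<bar>) * a1 + (\<bar>a1\<bar> + \<bar>b1\<bar>) * a2 = 0 \<and> (\<bar>a2\<bar> + \<bar>b2\<bar>) * b1 + (\<bar>a1\<bar> + \<bar>b1\<bar>) * b2 = 0"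
      proof -
        have k: "(\<bar>a2\<bar> + \<bar>b2\<bar>) * a1 + (\<bar>a1\<bar> + \<bar>b1\<bar>) * a2 = 0 \<and> (\<bar>a2\<bar> + \<bar>b2\<bar>) * b1 + (\<bar>a1\<bar> + \<bar>b1\<bar>) * b2 = 0"
          if "0 < a1" "0 < b1" "\<not> (0 < a2 \<and> 0 < b2)" "a1 * b2 = a2 * b1" for a1 b1 a2 b2 :: real
        proof -
          have "a2 \<le> 0 \<and> b2 \<le> 0"
            using that by (smt (verit) mult_pos_pos mult_nonneg_nonpos mult_nonpos_nonneg zero_less_mult_iff)
          then show ?thesis using that by (simp add: algebra_simps)
        qed
        show ?thesis
          using neq k[of a1 b1 a2 b2] k[of a2 b2 a1 b1] 3 by (auto simp: add.commute)
      qed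
      have "r \<in> {0..1}" using N by (auto simp: r_def N_def)
      moreover have "1 - r = (\<bar>a2\<bar> + \<bar>b2\<bar>) / N"
        using N by (simp add: r_def field_simps) (simp add: N_def)
      then have "(1 - r) * x + r * y = ((\<bar>a2\<bar> + \<bar>b2\<bar>) * x + (\<bar>a1\<bar> + \<bar>b1\<bar>) * y) / N" for x y
        by (simp only: r_def times_divide_eq_left flip: add_divide_distrib)
      ultimately show False using nz[of r] opp by simp
    qed
    with 3 show ?thesis by simp
  qed
qed

section \<open>The cone over a parallelogram and its boundary\<close>

definition parallelogram :: "real^3 \<Rightarrow> real^3 \<Rightarrow> real^3 \<Rightarrow> (real^3) set" where
  "parallelogram u v w = {u + s *\<^sub>R v + t *\<^sub>R w | s t. s \<in> {0..1} \<and> t \<in> {0..1}}"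

definition sector :: "real^3 \<Rightarrow> real^3 \<Rightarrow> (real^3) set" where
  "sector \<xi> \<zeta> = {a *\<^sub>R \<xi> + b *\<^sub>R \<zeta> | a b. 0 < a \<and> 0 < b}"

text \<open>
  The signed number of times the segment from \<open>x\<close> to \<open>y\<close> passes through the sector between \<open>\<xi>\<close>
  and \<open>\<zeta>\<close>, that is, the intersection number of the spherical arcs from \<open>x\<close> to \<open>y\<close> and from \<open>\<xi>\<close>
  to \<open>\<zeta>\<close>. Meaningful only if neither end lies in the plane of \<open>\<xi>\<close> and \<open>\<zeta>\<close>, except that an end may
  be the origin.
\<close>

definition flux :: "real^3 \<Rightarrow> real^3 \<Rightarrow> real^3 \<Rightarrow> real^3 \<Rightarrow> real" where
  "flux \<xi> \<zeta> x y =
     (if closed_segment x y \<inter> sector \<xi> \<zeta> = {} then 0 else sgn (cross3 \<xi> \<zeta> \<bullet> (y - x)))"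

lemma flux_swap: "flux \<xi> \<zeta> y x = - flux \<xi> \<zeta> x y"
proof -
  have "cross3 \<xi> \<zeta> \<bullet> (x - y) = - (cross3 \<xi> \<zeta> \<bullet> (y - x))"
    by (simp add: inner_diff_right)
  then show ?thesis
    by (simp add: flux_def closed_segment_commute sgn_minus)
qed

lemma cross3_coordinates:
  "cross3 (a *\<^sub>R \<xi> + b *\<^sub>R \<zeta>) (a' *\<^sub>R \<xi> + b' *\<^sub>R \<zeta>) = (a * b' - a' * b) *\<^sub>R cross3 \<xi> \<zeta>"
  by (simp add: cross3_simps forall_3)

text \<open>
  The coefficients come from expanding \<open>\<nu> \<times> (q \<times> \<nu>) = (\<nu> \<bullet> \<nu>) q\<close>, where \<open>\<nu> = \<xi> \<times> \<zeta>\<close>, by Lagrange's formula.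
\<close>

lemma plane_coordinates:
  assumes "cross3 \<xi> \<zeta> \<noteq> 0" "cross3 \<xi> \<zeta> \<bullet> q = 0"
  obtains a b where "q = a *\<^sub>R \<xi> + b *\<^sub>R \<zeta>"
proof -
  let ?\<nu> = "cross3 \<xi> \<zeta>"
  have "(?\<nu> \<bullet> ?\<nu>) *\<^sub>R q = cross3 ?\<nu> (cross3 q ?\<nu>)"
    unfolding Lagrange[of ?\<nu> q ?\<nu>] using assms(2) by simp
  also have "\<dots> = ((q \<bullet> \<xi>) * (\<zeta> \<bullet> \<zeta>) - (q \<bullet> \<zeta>) * (\<xi> \<bullet> \<zeta>)) *\<^sub>R \<xi>
      + ((q \<bullet> \<zeta>) * (\<xi> \<bullet> \<xi>) - (q \<bullet> \<xi>) * (\<xi> \<bullet> \<zeta>)) *\<^sub>R \<zeta>"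
    by (simp add: cross3_simps forall_3)
  finally have "(?\<nu> \<bullet> ?\<nu>) *\<^sub>R q = \<dots>" .
  moreover have "?\<nu> \<bullet> ?\<nu> \<noteq> 0" using assms(1) by simp
  ultimately have "q = (1 / (?\<nu> \<bullet> ?\<nu>)) *\<^sub>R (((q \<bullet> \<xi>) * (\<zeta> \<bullet> \<zeta>) - (q \<bullet> \<zeta>) * (\<xi> \<bullet> \<zeta>)) *\<^sub>R \<xi>
      + ((q \<bullet> \<zeta>) * (\<xi> \<bullet> \<xi>) - (q \<bullet> \<xi>) * (\<xi> \<bullet> \<zeta>)) *\<^sub>R \<zeta>)"
    by (metis (no_types, lifting) divide_self_if scaleR_one scaleR_scaleR times_divide_eq_left mult_1)
  then show ?thesis
    using that by (metis scaleR_add_right scaleR_scaleR)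
qed

lemma coordinates_unique:
  assumes "cross3 \<xi> \<zeta> \<noteq> 0"
  shows "a *\<^sub>R \<xi> + b *\<^sub>R \<zeta> = a' *\<^sub>R \<xi> + b' *\<^sub>R \<zeta> \<longleftrightarrow> a = a' \<and> b = b'"
proof
  assume eq: "a *\<^sub>R \<xi> + b *\<^sub>R \<zeta> = a' *\<^sub>R \<xi> + b' *\<^sub>R \<zeta>"
  have "a *\<^sub>R cross3 \<xi> \<zeta> = a' *\<^sub>R cross3 \<xi> \<zeta>"
    using arg_cong[OF eq, of "\<lambda>x. cross3 x \<zeta>"] by (simp add: cross_add_left cross_mult_left)
  moreover have "b *\<^sub>R cross3 \<xi> \<zeta> = b' *\<^sub>R cross3 \<xi> \<zeta>"
    using arg_cong[OF eq, of "cross3 \<xi>"] by (simp add: cross_add_right cross_mult_right)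
  ultimately show "a = a' \<and> b = b'" using assms by simp
qed simp

lemma sector_coordinates:
  assumes "cross3 \<xi> \<zeta> \<noteq> 0"
  shows "a *\<^sub>R \<xi> + b *\<^sub>R \<zeta> \<in> sector \<xi> \<zeta> \<longleftrightarrow> 0 < a \<and> 0 < b"
  using assms by (auto simp: sector_def coordinates_unique)

lemma sector_in_plane: "z \<in> sector \<xi> \<zeta> \<Longrightarrow> cross3 \<xi> \<zeta> \<bullet> z = 0"
  by (auto simp: sector_def inner_add_right dot_cross_self)

lemma flux_same_side:
  assumes "0 < (cross3 \<xi> \<zeta> \<bullet> x) * (cross3 \<xi> \<zeta> \<bullet> y)"
  shows "flux \<xi> \<zeta> x y = 0"
proof -
  let ?f = "\<lambda>z. cross3 \<xi> \<zeta> \<bullet> z"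
  have "?f z \<noteq> 0" if "z \<in> closed_segment x y" for z
  proof -
    from that obtain r where r: "0 \<le> r" "r \<le> 1" "z = (1 - r) *\<^sub>R x + r *\<^sub>R y"
      by (auto simp: in_segment)
    have "?f z * ?f x = (1 - r) * (?f x)\<^sup>2 + r * (?f x * ?f y)"
      by (simp add: r(3) power2_eq_square algebra_simps)
    also have "\<dots> > 0"
      using r(1,2) assms by (cases "r = 0") (auto intro: add_nonneg_pos)
    finally show ?thesis by auto
  qed
  then show ?thesis
    using sector_in_plane by (fastforce simp: flux_def)
qed

lemma flux_crossing:
  assumes "cross3 \<xi> \<zeta> \<bullet> x < 0" "0 < cross3 \<xi> \<zeta> \<bullet> y"
    and z: "z \<in> closed_segment x y" "cross3 \<xi> \<zeta> \<bullet> z = 0"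
  shows "flux \<xi> \<zeta> x y = of_bool (z \<in> sector \<xi> \<zeta>)"
proof -
  let ?f = "\<lambda>z. cross3 \<xi> \<zeta> \<bullet> z"
  have "z' = z" if z': "z' \<in> closed_segment x y" "?f z' = 0" for z'
  proof -
    obtain r r' where r: "z = (1 - r) *\<^sub>R x + r *\<^sub>R y" "z' = (1 - r') *\<^sub>R x + r' *\<^sub>R y"
      using z(1) z'(1) by (auto simp: in_segment)
    have "(r - r') * (?f y - ?f x) = ?f z - ?f z'"
      by (simp add: r algebra_simps)
    then have "r = r'" using assms(1,2) z(2) z'(2) by simp
    then show ?thesis by (simp add: r)
  qed
  then have "closed_segment x y \<inter> sector \<xi> \<zeta> = {} \<longleftrightarrow> z \<notin> sector \<xi> \<zeta>"
    using z(1) sector_in_plane by blast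
  then show ?thesis
    using assms(1,2) by (auto simp: flux_def inner_diff_right)
qed

text \<open>
  Taking the next corner as the base point describes the same parallelogram, its boundary and its
  boundary flux. These symmetries reduce the position of a parallelogram with respect to a plane
  to a few cases.
\<close>

lemma parallelogram_rotate: "parallelogram (u + v) w (- v) = parallelogram u v w"
proof (intro equalityI subsetI)
  fix x assume "x \<in> parallelogram (u + v) w (- v)"
  then obtain s t where "s \<in> {0..1}" "t \<in> {0..1}" "x = u + v + s *\<^sub>R w + t *\<^sub>R (- v)"
    unfolding parallelogram_def by blast
  then have "x = u + (1 - t) *\<^sub>R v + s *\<^sub>R w" "1 - t \<in> {0..1}" "s \<in> {0..1}"
    by (auto simp: algebra_simps)
  then show "x \<in> parallelogram u v w"
    unfolding parallelogram_def by blast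
next
  fix x assume "x \<in> parallelogram u v w"
  then obtain s t where "s \<in> {0..1}" "t \<in> {0..1}" "x = u + s *\<^sub>R v + t *\<^sub>R w"
    unfolding parallelogram_def by blast
  then have "x = u + v + t *\<^sub>R w + (1 - s) *\<^sub>R (- v)" "1 - s \<in> {0..1}" "t \<in> {0..1}"
    by (auto simp: algebra_simps)
  then show "x \<in> parallelogram (u + v) w (- v)"
    unfolding parallelogram_def by blast
qed

definition perimeter :: "real^3 \<Rightarrow> real^3 \<Rightarrow> real^3 \<Rightarrow> (real^3) set" where
  "perimeter u v w = closed_segment u (u + v) \<union> closed_segment (u + v) (u + v + w) \<union>
     closed_segment (u + v + w) (u + w) \<union> closed_segment (u + w) u"

definition perimeter_flux :: "real^3 \<Rightarrow> real^3 \<Rightarrow> real^3 \<Rightarrow> real^3 \<Rightarrow> real^3 \<Rightarrow> real" where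
  "perimeter_flux \<xi> \<zeta> u v w = flux \<xi> \<zeta> u (u + v) + flux \<xi> \<zeta> (u + v) (u + v + w) +
     flux \<xi> \<zeta> (u + v + w) (u + w) + flux \<xi> \<zeta> (u + w) u"

definition ray :: "real^3 \<Rightarrow> (real^3) set" where
  "ray \<xi> = {c *\<^sub>R \<xi> | c. 0 < c}"

lemma perimeter_rotate: "perimeter (u + v) w (- v) = perimeter u v w"
  by (auto simp: perimeter_def)

lemma perimeter_flux_rotate: "perimeter_flux \<xi> \<zeta> (u + v) w (- v) = perimeter_flux \<xi> \<zeta> u v w"
  by (auto simp: perimeter_flux_def)

lemma ray_coordinates:
  assumes "cross3 \<xi> \<zeta> \<noteq> 0"
  shows "a *\<^sub>R \<xi> + b *\<^sub>R \<zeta> \<in> ray \<xi> \<longleftrightarrow> b = 0 \<and> 0 < a"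
    and "a *\<^sub>R \<xi> + b *\<^sub>R \<zeta> \<in> ray \<zeta> \<longleftrightarrow> a = 0 \<and> 0 < b"
proof -
  have "a *\<^sub>R \<xi> + b *\<^sub>R \<zeta> = c *\<^sub>R \<xi> \<longleftrightarrow> a = c \<and> b = 0" "a *\<^sub>R \<xi> + b *\<^sub>R \<zeta> = c *\<^sub>R \<zeta> \<longleftrightarrow> a = 0 \<and> b = c" for c
    using coordinates_unique[OF assms, of a b c 0] coordinates_unique[OF assms, of a b 0 c] by simp_all
  then show "a *\<^sub>R \<xi> + b *\<^sub>R \<zeta> \<in> ray \<xi> \<longleftrightarrow> b = 0 \<and> 0 < a" "a *\<^sub>R \<xi> + b *\<^sub>R \<zeta> \<in> ray \<zeta> \<longleftrightarrow> a = 0 \<and> 0 < b"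
    by (auto simp: ray_def)
qed

text \<open>
  \<open>quadrant_crossing\<close>, read in the plane of \<open>\<xi>\<close> and \<open>\<zeta>\<close> with these two vectors as basis.
\<close>

lemma segment_ray_flux:
  assumes \<nu>: "cross3 \<xi> \<zeta> \<noteq> 0" "cross3 \<xi> \<zeta> \<bullet> q1 = 0" "cross3 \<xi> \<zeta> \<bullet> q2 = 0"
    and D: "cross3 q1 q2 = D *\<^sub>R cross3 \<xi> \<zeta>"
    and "0 \<notin> closed_segment q1 q2"
    and "q1 \<notin> ray \<xi> \<union> ray \<zeta>" "q2 \<notin> ray \<xi> \<union> ray \<zeta>"
  shows "sgn D * (of_bool (closed_segment q1 q2 \<inter> ray \<xi> \<noteq> {}) - of_bool (closed_segment q1 q2 \<inter> ray \<zeta> \<noteq> {}))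
       = of_bool (q2 \<in> sector \<xi> \<zeta>) - of_bool (q1 \<in> sector \<xi> \<zeta>)"
proof -
  obtain a1 b1 where q1: "q1 = a1 *\<^sub>R \<xi> + b1 *\<^sub>R \<zeta>" using plane_coordinates \<nu>(1,2) by blast
  obtain a2 b2 where q2: "q2 = a2 *\<^sub>R \<xi> + b2 *\<^sub>R \<zeta>" using plane_coordinates \<nu>(1,3) by blast
  have comb: "(1 - r) *\<^sub>R q1 + r *\<^sub>R q2 = ((1 - r) * a1 + r * a2) *\<^sub>R \<xi> + ((1 - r) * b1 + r * b2) *\<^sub>R \<zeta>" for r
    by (simp add: q1 q2 algebra_simps)
  have seg: "z \<in> closed_segment q1 q2 \<longleftrightarrow> (\<exists>r\<in>{0..1}. z = (1 - r) *\<^sub>R q1 + r *\<^sub>R q2)" for z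
    by (auto simp: in_segment)
  have D': "D = a1 * b2 - a2 * b1"
    using D \<nu>(1) by (simp add: q1 q2 cross3_coordinates)
  have hit: "closed_segment q1 q2 \<inter> ray \<xi> \<noteq> {} \<longleftrightarrow>
      (\<exists>r\<in>{0..1}. (1 - r) * b1 + r * b2 = 0 \<and> 0 < (1 - r) * a1 + r * a2)"
    "closed_segment q1 q2 \<inter> ray \<zeta> \<noteq> {} \<longleftrightarrow>
      (\<exists>r\<in>{0..1}. (1 - r) * a1 + r * a2 = 0 \<and> 0 < (1 - r) * b1 + r * b2)"
    using ray_coordinates[OF \<nu>(1)] comb seg by (metis (no_types, lifting) disjoint_iff)+
  have nz: "(1 - r) * a1 + r * a2 \<noteq> 0 \<or> (1 - r) * b1 + r * b2 \<noteq> 0" if "r \<in> {0..1}" for r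
    using assms(5) that comb[of r] seg[of 0] by fastforce
  show ?thesis
    unfolding hit
    using assms(6,7) unfolding q1 q2 D' sector_coordinates[OF \<nu>(1)] Un_iff ray_coordinates[OF \<nu>(1)]
    by (intro quadrant_crossing[OF nz]) auto
qed

text \<open>
  The plane of \<open>\<xi>\<close> and \<open>\<zeta>\<close> enters the parallelogram through the edge from \<open>u\<close> to \<open>u + v\<close> and leaves
  it through one of the three others. The intersection is a segment from the entry point to the
  exit point. Its ends account for the flux through the boundary, while the rays \<open>\<xi>\<close> and \<open>\<zeta>\<close> meet
  the parallelogram exactly where they meet this segment, so \<open>segment_ray_flux\<close> compares the two.
\<close>

lemma parallelogram_flux_entry:
  fixes u v w \<xi> \<zeta> :: "real^3"
  defines "f \<equiv> \<lambda>x. cross3 \<xi> \<zeta> \<bullet> x"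
  assumes f: "f u < 0" "0 < f (u + v)" "f (u + v + w) \<noteq> 0" "f (u + w) \<noteq> 0"
    and nz: "0 \<notin> parallelogram u v w"
    and clear: "perimeter u v w \<inter> (ray \<xi> \<union> ray \<zeta>) = {}"
  shows "sgn (u \<bullet> cross3 v w) * (of_bool (parallelogram u v w \<inter> ray \<xi> \<noteq> {}) -
           of_bool (parallelogram u v w \<inter> ray \<zeta> \<noteq> {})) = perimeter_flux \<xi> \<zeta> u v w"
proof -
  have fadd: "f (x + y) = f x + f y" and fscale: "f (c *\<^sub>R x) = c * f x" for x y c
    by (simp_all add: f_def inner_add_right)
  have \<nu>: "cross3 \<xi> \<zeta> \<noteq> 0" using f(1) by (auto simp: f_def)
  have fv: "0 < f v" using f(1,2) by (simp add: fadd)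
  \<comment> \<open>The plane meets the bottom edge at parameter \<open>s\<close>; \<open>q t\<close> is its point at height \<open>t\<close> above that edge.\<close>
  define s where "s = - f u / f v"
  define g where "g = f w / f v"
  have s: "0 < s" "s < 1" "f u = - s * f v"
    using f(1,2) fv by (auto simp: s_def fadd field_simps)
  have g: "f w = g * f v" using fv by (simp add: g_def)
  define q where "q t = u + (s - t * g) *\<^sub>R v + t *\<^sub>R w" for t
  have fq: "f (q t) = 0" for t by (simp only: q_def fadd fscale s(3) g) (simp add: algebra_simps)
  have bottom: "flux \<xi> \<zeta> u (u + v) = of_bool (q 0 \<in> sector \<xi> \<zeta>)" "q 0 \<in> perimeter u v w"
  proof -
    have "q 0 \<in> closed_segment u (u + v)"
      using s by (auto simp: q_def in_segment algebra_simps intro!: exI[of _ s])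
    then show "flux \<xi> \<zeta> u (u + v) = of_bool (q 0 \<in> sector \<xi> \<zeta>)" "q 0 \<in> perimeter u v w"
      using flux_crossing f(1,2) fq[of 0] by (auto simp: f_def perimeter_def)
  qed
  have fu: "f (u + w) = (g - s) * f v" "f (u + v + w) = (1 + g - s) * f v"
    by (simp_all add: fadd s(3) g algebra_simps)
  \<comment> \<open>\<open>q \<tau>\<close> is the exit point, on the top, the left or the right edge.\<close>
  have "\<exists>\<tau>. 0 < \<tau> \<and> (\<forall>t. t \<in> {0..1} \<and> s - t * g \<in> {0..1} \<longleftrightarrow> t \<in> {0..\<tau>}) \<and>
      q \<tau> \<in> perimeter u v w \<and>
      flux \<xi> \<zeta> (u + v) (u + v + w) + flux \<xi> \<zeta> (u + v + w) (u + w) + flux \<xi> \<zeta> (u + w) u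
        = - of_bool (q \<tau> \<in> sector \<xi> \<zeta>)"
  proof -
    consider (top) "g < s" "s < 1 + g" | (left) "s < g" | (right) "1 + g < s"
      using f(3,4) fv unfolding fu by force
    then show ?thesis
    proof cases
      case top
      have "q 1 \<in> closed_segment (u + w) (u + v + w)"
        using top by (auto simp: q_def in_segment algebra_simps intro!: exI[of _ "s - g"])
      moreover have "f (u + w) < 0" "0 < f (u + v + w)"
        using top fv by (simp_all add: fu mult_neg_pos)
      ultimately have "flux \<xi> \<zeta> (u + w) (u + v + w) = of_bool (q 1 \<in> sector \<xi> \<zeta>)" "q 1 \<in> perimeter u v w"
        using flux_crossing fq[of 1] by (auto simp: f_def perimeter_def closed_segment_commute)
      moreover have "flux \<xi> \<zeta> (u + v) (u + v + w) = 0" "flux \<xi> \<zeta> (u + w) u = 0"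
        using \<open>f (u + w) < 0\<close> \<open>0 < f (u + v + w)\<close> f(1,2) unfolding f_def
        by (auto intro!: flux_same_side simp: zero_less_mult_iff)
      moreover have "t \<in> {0..1} \<and> s - t * g \<in> {0..1} \<longleftrightarrow> t \<in> {0..1}" for t
      proof -
        have "0 \<le> s - t * g \<and> s - t * g \<le> 1" if "0 \<le> t" "t \<le> 1"
        proof -
          have "s - t * g = (1 - t) * s + t * (s - g)" by (simp add: algebra_simps)
          moreover have "(1 - t) * s + t * (s - g) \<le> (1 - t) * 1 + t * 1"
            using that s top by (intro add_mono mult_left_mono) auto
          ultimately show ?thesis using that s top by auto
        qed
        then show ?thesis by auto
      qed
      ultimately show ?thesis
        using flux_swap[of \<xi> \<zeta> "u + v + w" "u + w"] by (intro exI[of _ 1]) simp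
    next
      case left
      define \<tau> where "\<tau> = s / g"
      have \<tau>: "0 < \<tau>" "\<tau> < 1" "s = \<tau> * g" using left s by (auto simp: \<tau>_def)
      have "q \<tau> \<in> closed_segment u (u + w)"
        using \<tau> by (auto simp: q_def in_segment algebra_simps intro!: exI[of _ \<tau>])
      moreover have pos: "0 < f (u + w)" "0 < f (u + v + w)"
        using left fv s by (simp_all add: fu)
      ultimately have "flux \<xi> \<zeta> u (u + w) = of_bool (q \<tau> \<in> sector \<xi> \<zeta>)" "q \<tau> \<in> perimeter u v w"
        using flux_crossing f(1) fq[of \<tau>] by (auto simp: f_def perimeter_def closed_segment_commute)
      moreover have "flux \<xi> \<zeta> (u + v) (u + v + w) = 0" "flux \<xi> \<zeta> (u + v + w) (u + w) = 0"
        using pos f(2) unfolding f_def by (auto intro!: flux_same_side simp: zero_less_mult_iff)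
      moreover have "t \<in> {0..1} \<and> s - t * g \<in> {0..1} \<longleftrightarrow> t \<in> {0..\<tau>}" for t
      proof -
        have "s - t * g = (\<tau> - t) * g" by (simp add: \<tau>(3) algebra_simps)
        moreover have "0 \<le> (\<tau> - t) * g \<longleftrightarrow> t \<le> \<tau>" using left s by (auto simp: zero_le_mult_iff)
        moreover have "(\<tau> - t) * g \<le> \<tau> * g" if "0 \<le> t"
          using that left s by (intro mult_right_mono) auto
        ultimately show ?thesis using \<tau>(2,3) s(2) by force
      qed
      ultimately show ?thesis
        using flux_swap[of \<xi> \<zeta> "u + w" u] \<tau>(1) by (intro exI[of _ \<tau>]) simp
    next
      case right
      define \<tau> where "\<tau> = (1 - s) / (- g)"
      have gneg: "g < 0" using right s by simp
      have \<tau>: "0 < \<tau>" "\<tau> < 1" "s - \<tau> * g = 1" using right gneg s by (auto simp: \<tau>_def field_simps)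
      have "q \<tau> \<in> closed_segment (u + v + w) (u + v)"
        using \<tau> by (auto simp: q_def in_segment algebra_simps intro!: exI[of _ "1 - \<tau>"])
      moreover have neg: "f (u + w) < 0" "f (u + v + w) < 0"
        using right fv s gneg by (simp_all add: fu mult_neg_pos)
      ultimately have "flux \<xi> \<zeta> (u + v + w) (u + v) = of_bool (q \<tau> \<in> sector \<xi> \<zeta>)" "q \<tau> \<in> perimeter u v w"
        using flux_crossing f(2) fq[of \<tau>] by (auto simp: f_def perimeter_def closed_segment_commute)
      moreover have "flux \<xi> \<zeta> (u + v + w) (u + w) = 0" "flux \<xi> \<zeta> (u + w) u = 0"
        using neg f(1) unfolding f_def by (auto intro!: flux_same_side simp: zero_less_mult_iff)
      moreover have "t \<in> {0..1} \<and> s - t * g \<in> {0..1} \<longleftrightarrow> t \<in> {0..\<tau>}" for t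
      proof -
        have "s - t * g = 1 + (\<tau> - t) * g"
          using \<tau>(3) left_diff_distrib[of \<tau> t g] by linarith
        moreover have "(\<tau> - t) * g \<le> 0 \<longleftrightarrow> t \<le> \<tau>" using gneg by (auto simp: mult_le_0_iff)
        moreover have "\<tau> * g \<le> (\<tau> - t) * g" if "0 \<le> t"
          using that gneg by (intro mult_right_mono_neg) auto
        ultimately show ?thesis
          using \<tau>(2,3) s(1) unfolding atLeastAtMost_iff by (smt (verit))
      qed
      ultimately show ?thesis
        using flux_swap[of \<xi> \<zeta> "u + v + w" "u + v"] \<tau>(1) by (intro exI[of _ \<tau>]) simp
    qed
  qed
  then obtain \<tau> where \<tau>: "0 < \<tau>" "q \<tau> \<in> perimeter u v w"
      "\<And>t. t \<in> {0..1} \<and> s - t * g \<in> {0..1} \<longleftrightarrow> t \<in> {0..\<tau>}"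
      "flux \<xi> \<zeta> (u + v) (u + v + w) + flux \<xi> \<zeta> (u + v + w) (u + w) + flux \<xi> \<zeta> (u + w) u
        = - of_bool (q \<tau> \<in> sector \<xi> \<zeta>)"
    by blast
  have mem: "x \<in> parallelogram u v w \<longleftrightarrow> x \<in> closed_segment (q 0) (q \<tau>)" if fx: "f x = 0" for x
  proof
    assume "x \<in> parallelogram u v w"
    then obtain s' t where x: "s' \<in> {0..1}" "t \<in> {0..1}" "x = u + s' *\<^sub>R v + t *\<^sub>R w"
      unfolding parallelogram_def by blast
    have "(s' - (s - t * g)) * f v = 0"
      using fx by (simp add: x(3) fadd fscale s(3) g algebra_simps)
    then have s': "s' = s - t * g" using fv by simp
    then have "t \<in> {0..\<tau>}" using x(1,2) \<tau>(3)[of t] by simp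
    moreover have "x = (1 - t / \<tau>) *\<^sub>R q 0 + (t / \<tau>) *\<^sub>R q \<tau>"
      using \<tau>(1) by (simp add: x(3) s' q_def algebra_simps)
    ultimately show "x \<in> closed_segment (q 0) (q \<tau>)"
      using \<tau>(1) \<open>t \<in> {0..\<tau>}\<close> unfolding in_segment by (intro exI[of _ "t / \<tau>"]) simp
  next
    assume "x \<in> closed_segment (q 0) (q \<tau>)"
    then obtain r where r: "0 \<le> r" "r \<le> 1" "x = (1 - r) *\<^sub>R q 0 + r *\<^sub>R q \<tau>"
      by (auto simp: in_segment)
    then have "r * \<tau> \<in> {0..\<tau>}" using \<tau>(1) by (auto simp: mult_le_cancel_right1)
    then have "r * \<tau> \<in> {0..1}" "s - r * \<tau> * g \<in> {0..1}" using \<tau>(3)[of "r * \<tau>"] by auto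
    moreover have "x = u + (s - r * \<tau> * g) *\<^sub>R v + (r * \<tau>) *\<^sub>R w"
      by (simp add: r(3) q_def algebra_simps)
    ultimately show "x \<in> parallelogram u v w"
      unfolding parallelogram_def by blast
  qed
  have "f 0 = 0" by (simp add: f_def)
  with mem nz have nz': "0 \<notin> closed_segment (q 0) (q \<tau>)" by blast
  have "x \<in> ray \<xi> \<union> ray \<zeta> \<Longrightarrow> f x = 0" for x
    by (auto simp: ray_def f_def dot_cross_self)
  then have hit: "parallelogram u v w \<inter> ray \<xi> = closed_segment (q 0) (q \<tau>) \<inter> ray \<xi>"
      "parallelogram u v w \<inter> ray \<zeta> = closed_segment (q 0) (q \<tau>) \<inter> ray \<zeta>"
    using mem by auto
  obtain a1 b1 where q1: "q 0 = a1 *\<^sub>R \<xi> + b1 *\<^sub>R \<zeta>" using plane_coordinates \<nu> fq unfolding f_def by blast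
  obtain a2 b2 where q2: "q \<tau> = a2 *\<^sub>R \<xi> + b2 *\<^sub>R \<zeta>" using plane_coordinates \<nu> fq unfolding f_def by blast
  define D where "D = a1 * b2 - a2 * b1"
  have D: "cross3 (q 0) (q \<tau>) = D *\<^sub>R cross3 \<xi> \<zeta>"
    by (simp add: q1 q2 cross3_coordinates D_def)
  \<comment> \<open>The turning direction of the segment inside the plane is opposite to the orientation of the
      parallelogram.\<close>
  have "D * f v = v \<bullet> cross3 (q 0) (q \<tau>)"
    by (simp add: D f_def inner_commute)
  also have "\<dots> = - \<tau> * (u \<bullet> cross3 v w)"
    by (simp add: q_def cross3_simps)
  finally have "sgn (D * f v) = sgn (- \<tau> * (u \<bullet> cross3 v w))" by simp
  then have sgnD: "sgn (u \<bullet> cross3 v w) = - sgn D"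
    using fv \<tau>(1) by (simp add: sgn_mult)
  have clear': "q 0 \<notin> ray \<xi> \<union> ray \<zeta>" "q \<tau> \<notin> ray \<xi> \<union> ray \<zeta>"
    using clear bottom(2) \<tau>(2) by auto
  show ?thesis
    using segment_ray_flux[OF \<nu> fq[unfolded f_def] fq[unfolded f_def] D nz' clear']
    unfolding sgnD hit perimeter_flux_def bottom(1) using \<tau>(4) by simp
qed

text \<open>
  The boundary formula on which the argument rests. The cone over the parallelogram is a
  region of the sphere, counted with the orientation \<open>sgn (u \<bullet> (v \<times> w))\<close>; moving from \<open>\<zeta>\<close> to \<open>\<xi>\<close>
  changes membership in this region by the signed number of boundary crossings. If the
  parallelogram lies in a plane through the origin, both sides are zero.
\<close>

lemma parallelogram_flux:
  fixes u v w \<xi> \<zeta> :: "real^3"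
  defines "f \<equiv> \<lambda>x. cross3 \<xi> \<zeta> \<bullet> x"
  assumes f: "f u \<noteq> 0" "f (u + v) \<noteq> 0" "f (u + v + w) \<noteq> 0" "f (u + w) \<noteq> 0"
    and nz: "0 \<notin> parallelogram u v w"
    and clear: "perimeter u v w \<inter> (ray \<xi> \<union> ray \<zeta>) = {}"
  shows "sgn (u \<bullet> cross3 v w) * (of_bool (parallelogram u v w \<inter> ray \<xi> \<noteq> {}) -
           of_bool (parallelogram u v w \<inter> ray \<zeta> \<noteq> {})) = perimeter_flux \<xi> \<zeta> u v w"
proof -
  let ?G = "\<lambda>u v w. sgn (u \<bullet> cross3 v w) * (of_bool (parallelogram u v w \<inter> ray \<xi> \<noteq> {}) -
           of_bool (parallelogram u v w \<inter> ray \<zeta> \<noteq> {})) = perimeter_flux \<xi> \<zeta> u v w"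
  have rot: "?G (u + v) w (- v) \<longleftrightarrow> ?G u v w" for u v w
  proof -
    have "(u + v) \<bullet> cross3 w (- v) = u \<bullet> cross3 v w"
      by (simp add: cross3_simps)
    then show ?thesis by (simp add: parallelogram_rotate perimeter_flux_rotate)
  qed
  have entry: "?G u v w" if "f u < 0" "0 < f (u + v)" "f (u + v + w) \<noteq> 0" "f (u + w) \<noteq> 0"
    "0 \<notin> parallelogram u v w" "perimeter u v w \<inter> (ray \<xi> \<union> ray \<zeta>) = {}" for u v w
    using parallelogram_flux_entry that unfolding f_def by blast
  have fadd: "f (x + y) = f x + f y" and fscale: "f (c *\<^sub>R x) = c * f x" for x y c
    by (simp_all add: f_def inner_add_right)
  note rots = parallelogram_rotate perimeter_rotate
  have rot2: "parallelogram (u + v + w) (- v) (- w) = parallelogram u v w"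
       "perimeter (u + v + w) (- v) (- w) = perimeter u v w"
    using rots[of "u + v" w "- v"] rots[of u v w] by simp_all
  have rot3: "parallelogram (u + w) (- w) v = parallelogram u v w"
       "perimeter (u + w) (- w) v = perimeter u v w"
    using rots[of "u + v + w" "- v" "- w"] rot2 by simp_all
  \<comment> \<open>Around the four corners \<open>f\<close> has one sign, or there is an edge along which it changes from
      negative to positive; the parallelogram is then rotated so that this is the entry edge.\<close>
  consider (same) e :: real where "0 < e * f u" "0 < e * f (u + v)"
      "0 < e * f (u + v + w)" "0 < e * f (u + w)"
    | (1) "f u < 0" "0 < f (u + v)" | (2) "f (u + v) < 0" "0 < f (u + v + w)"
    | (3) "f (u + v + w) < 0" "0 < f (u + w)" | (4) "f (u + w) < 0" "0 < f u"
  proof (cases "0 < f u \<and> 0 < f (u + v) \<and> 0 < f (u + v + w) \<and> 0 < f (u + w) \<or>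
      f u < 0 \<and> f (u + v) < 0 \<and> f (u + v + w) < 0 \<and> f (u + w) < 0")
    case True
    then show ?thesis using that(1)[of 1] that(1)[of "- 1"] by auto
  next
    case False
    then show ?thesis using f that(2-5) by (meson linorder_neqE_linordered_idom)
  qed
  then show ?thesis
  proof cases
    case same
    have same2: "0 < x * y" if "0 < e * x" "0 < e * y" for x y :: real
      using that by (auto simp: zero_less_mult_iff)
    have "perimeter_flux \<xi> \<zeta> u v w = 0"
      using same same2 unfolding perimeter_flux_def f_def by (simp add: flux_same_side)
    moreover have "f x \<noteq> 0" if "x \<in> parallelogram u v w" for x
    proof -
      from that obtain s t where x: "s \<in> {0..1}" "t \<in> {0..1}" "x = u + s *\<^sub>R v + t *\<^sub>R w"
        unfolding parallelogram_def by blast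
      have "e * f x = (1 - s) * ((1 - t) * (e * f u) + t * (e * f (u + w))) +
          s * ((1 - t) * (e * f (u + v)) + t * (e * f (u + v + w)))"
        by (simp add: x(3) fadd fscale algebra_simps)
      moreover have comb: "0 < (1 - r) * a + r * b" if "r \<in> {0..1}" "0 < a" "0 < b" for r a b :: real
        using that by (cases "r = 0") (auto intro!: add_nonneg_pos)
      ultimately have "0 < e * f x"
        using same x(1,2) by (simp only:)
      then show ?thesis by auto
    qed
    then have "parallelogram u v w \<inter> ray \<xi> = {}" "parallelogram u v w \<inter> ray \<zeta> = {}"
      by (fastforce simp: ray_def f_def dot_cross_self)+
    ultimately show ?thesis by simp
  next
    case 1
    then show ?thesis using entry f nz clear by blast
  next
    case 2
    have "?G (u + v) w (- v)"
      using 2 f nz clear by (intro entry) (simp_all add: rots)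
    then show ?thesis by (simp only: rot)
  next
    case 3
    have "?G (u + v + w) (- v) (- w)"
      using 3 f nz clear by (intro entry) (simp_all add: rot2)
    then show ?thesis using rot[of u v w] rot[of "u + v" w "- v"] by simp
  next
    case 4
    have "?G (u + w) (- w) v"
      using 4 f nz clear by (intro entry) (simp_all add: rot3 add.commute add.left_commute)
    then show ?thesis using rot[of u v w] rot[of "u + v" w "- v"] rot[of "u + v + w" "- v" "- w"] by simp
  qed
qed

section \<open>The change of crossings along an arc of directions\<close>

definition edge :: "nat \<Rightarrow> (nat \<Rightarrow> real^3) \<Rightarrow> nat \<Rightarrow> real^3" where
  "edge n p i = p (Suc i mod n) - p i"

text \<open>
  The sign of a crossing of two skew lines depends on the lines and not on the direction from
  which it is seen: it is the sign of this triple product, which is symmetric in the two lines.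
\<close>

definition crossing_chirality :: "nat \<Rightarrow> (nat \<Rightarrow> real^3) \<Rightarrow> nat \<Rightarrow> nat \<Rightarrow> real" where
  "crossing_chirality n p i j = sgn ((p i - p j) \<bullet> cross3 (edge n p i) (edge n p j))"

definition lies_over :: "real^3 \<Rightarrow> (real^3) set \<Rightarrow> (real^3) set \<Rightarrow> bool" where
  "lies_over \<xi> A B \<longleftrightarrow> (\<exists>x\<in>A. \<exists>y\<in>B. x - y \<in> ray \<xi>)"

text \<open>
  The ordered pair \<open>(i, j)\<close> records a crossing in which segment \<open>i\<close> is above segment \<open>j\<close>. In contrast to
  the Tait number, this expression makes sense in every direction, in particular where
  three strands project to one point.
\<close>

definition signed_crossings :: "nat \<Rightarrow> (nat \<Rightarrow> real^3) \<Rightarrow> real^3 \<Rightarrow> real" where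
  "signed_crossings n p \<xi> = (\<Sum>i<n. \<Sum>j<n.
     crossing_chirality n p i j * of_bool (lies_over \<xi> (segment n p i) (segment n p j)))"

text \<open>
  Seen along \<open>\<xi>\<close>, no vertex covers or is covered by another point of \<open>K\<close>. This weakens good
  projections by allowing multiple points of interior points; its advantage is that the
  directions excluded lie on finitely many planes.
\<close>

definition vertex_free :: "(real^3) set \<Rightarrow> nat \<Rightarrow> (nat \<Rightarrow> real^3) \<Rightarrow> real^3 \<Rightarrow> bool" where
  "vertex_free K n p \<xi> \<longleftrightarrow> (\<forall>k<n. \<forall>y\<in>K. y \<noteq> p k \<longrightarrow> (\<forall>c. p k - y \<noteq> c *\<^sub>R \<xi>))"

lemma in_segment_edge: "x \<in> segment n p i \<longleftrightarrow> (\<exists>s\<in>{0..1}. x = p i + s *\<^sub>R edge n p i)"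
  by (auto simp: segment_def in_segment edge_def algebra_simps)

text \<open>
  Segment \<open>i\<close> lies over segment \<open>j\<close> along \<open>\<xi>\<close> if and only if \<open>\<xi>\<close> points to their difference set, which
  is a parallelogram. Each edge of it consists of the differences between a vertex and a segment.
\<close>

lemma difference_set_parallelogram:
  "z \<in> parallelogram (p i - p j) (edge n p i) (- edge n p j) \<longleftrightarrow>
     (\<exists>x\<in>segment n p i. \<exists>y\<in>segment n p j. z = x - y)"
proof
  assume "z \<in> parallelogram (p i - p j) (edge n p i) (- edge n p j)"
  then obtain s t where st: "s \<in> {0..1}" "t \<in> {0..1}"
      "z = p i - p j + s *\<^sub>R edge n p i + t *\<^sub>R (- edge n p j)"
    unfolding parallelogram_def by blast
  then have "z = (p i + s *\<^sub>R edge n p i) - (p j + t *\<^sub>R edge n p j)" by simp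
  with st(1,2) show "\<exists>x\<in>segment n p i. \<exists>y\<in>segment n p j. z = x - y"
    unfolding Bex_def in_segment_edge by blast
next
  assume "\<exists>x\<in>segment n p i. \<exists>y\<in>segment n p j. z = x - y"
  then obtain s t where st: "s \<in> {0..1}" "t \<in> {0..1}"
      "z = (p i + s *\<^sub>R edge n p i) - (p j + t *\<^sub>R edge n p j)"
    unfolding Bex_def in_segment_edge by blast
  then have "z = p i - p j + s *\<^sub>R edge n p i + t *\<^sub>R (- edge n p j)" by simp
  with st(1,2) show "z \<in> parallelogram (p i - p j) (edge n p i) (- edge n p j)"
    unfolding parallelogram_def by blast
qed

lemma lies_over_parallelogram:
  "lies_over \<xi> (segment n p i) (segment n p j) \<longleftrightarrow>
     parallelogram (p i - p j) (edge n p i) (- edge n p j) \<inter> ray \<xi> \<noteq> {}"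
  unfolding lies_over_def disjoint_iff difference_set_parallelogram by blast

lemma segment_difference_corners:
  "p i - p j + edge n p i = p (Suc i mod n) - p j"
  "p i - p j + edge n p i + - edge n p j = p (Suc i mod n) - p (Suc j mod n)"
  "p i - p j + - edge n p j = p i - p (Suc j mod n)"
  by (simp_all add: edge_def)

lemma closed_segment_diff_left:
  "closed_segment (a - c) (b - c) = (\<lambda>x. x - c) ` closed_segment a (b :: 'a :: real_vector)"
  using closed_segment_translation[of "- c" a b] by (simp add: add.commute)

lemma closed_segment_diff_right:
  "closed_segment (a - b) (a - c) = (\<lambda>x. a - x) ` closed_segment b (c :: 'a :: real_vector)"
proof -
  have "closed_segment (a - b) (a - c) = (\<lambda>x. a + x) ` uminus ` closed_segment b c"
    using closed_segment_translation[of a "- b" "- c"] closed_segment_linear_image[of uminus b c]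
    by (simp add: linear_uminus)
  then show ?thesis by (simp add: image_image)
qed

lemma sum_cyclic_shift: "(\<Sum>i<n. f (Suc i mod n)) = (\<Sum>i<n. f i)"
  for f :: "nat \<Rightarrow> 'a :: comm_monoid_add"
proof (rule sum.reindex_bij_witness[where i = "\<lambda>i. (i + n - 1) mod n" and j = "\<lambda>i. Suc i mod n"])
  show "(Suc a mod n + n - 1) mod n = a" if "a \<in> {..<n}" for a
    using that by (cases "Suc a = n") auto
  show "Suc ((b + n - 1) mod n) mod n = b" if "b \<in> {..<n}" for b
    using that by (cases b) (auto simp: mod_Suc)
qed auto

text \<open>
  An edge of a difference parallelogram belongs to a vertex and a segment. The two segments that
  meet at the vertex contribute this edge with opposite orientations, so in the cyclic sum over
  all pairs everything cancels.
\<close>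

lemma perimeter_flux_telescopes:
  "(\<Sum>i<n. \<Sum>j<n. perimeter_flux \<xi> \<zeta> (p i - p j) (edge n p i) (- edge n p j)) = 0"
proof -
  \<comment> \<open>The edges of vertex \<open>j\<close> with segment \<open>i\<close>, and of vertex \<open>i\<close> with segment \<open>j\<close>.\<close>
  define H where "H i j = flux \<xi> \<zeta> (p i - p j) (p (Suc i mod n) - p j)" for i j
  define V where "V i j = flux \<xi> \<zeta> (p i - p j) (p i - p (Suc j mod n))" for i j
  have "perimeter_flux \<xi> \<zeta> (p i - p j) (edge n p i) (- edge n p j) =
      (H i j - H i (Suc j mod n)) + (V (Suc i mod n) j - V i j)" for i j
    unfolding perimeter_flux_def segment_difference_corners H_def V_def
    using flux_swap[of \<xi> \<zeta> "p (Suc i mod n) - p (Suc j mod n)" "p i - p (Suc j mod n)"]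
      flux_swap[of \<xi> \<zeta> "p i - p (Suc j mod n)" "p i - p j"] by simp
  then have "(\<Sum>i<n. \<Sum>j<n. perimeter_flux \<xi> \<zeta> (p i - p j) (edge n p i) (- edge n p j)) =
      (\<Sum>i<n. (\<Sum>j<n. H i j) - (\<Sum>j<n. H i (Suc j mod n))) +
      ((\<Sum>i<n. \<Sum>j<n. V (Suc i mod n) j) - (\<Sum>i<n. \<Sum>j<n. V i j))"
    by (simp add: sum.distrib sum_subtractf)
  also have "\<dots> = 0"
    using sum_cyclic_shift[of "\<lambda>i. \<Sum>j<n. V i j" n] by (simp add: sum_cyclic_shift)
  finally show ?thesis .
qed

text \<open>
  The arc \<open>\<Gamma>\<^sub>i\<close> consists of the directions of the positive combinations of two consecutive edges.
\<close>

lemma positive_cone_indicatrix: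
  assumes "i < n" and x: "x = a *\<^sub>R edge n p i + b *\<^sub>R edge n p (Suc i mod n)" "0 \<le> a" "0 \<le> b" "x \<noteq> 0"
  shows "sgn x \<in> indicatrix n p" "sgn (- x) \<in> indicatrix n p"
proof -
  have edge: "edge n p k = norm (edge n p k) *\<^sub>R segment_dir n p k" for k
    by (cases "edge n p k = 0") (simp_all add: segment_dir_def edge_def sgn_div_norm)
  let ?a = "inverse (norm x) * a * norm (edge n p i)"
  let ?b = "inverse (norm x) * b * norm (edge n p (Suc i mod n))"
  have "sgn x = inverse (norm x) *\<^sub>R (a *\<^sub>R (norm (edge n p i) *\<^sub>R segment_dir n p i) +
      b *\<^sub>R (norm (edge n p (Suc i mod n)) *\<^sub>R segment_dir n p (Suc i mod n)))"
    unfolding sgn_div_norm x(1) edge[symmetric] ..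
  also have "\<dots> = ?a *\<^sub>R segment_dir n p i + ?b *\<^sub>R segment_dir n p (Suc i mod n)"
    by (simp add: scaleR_add_right mult.assoc)
  finally have "sgn x = \<dots>" .
  moreover have "0 \<le> ?a" "0 \<le> ?b" using x(2,3) by simp_all
  moreover have "sgn x \<in> sphere 0 1" using x(4) by (simp add: norm_sgn)
  ultimately have "sgn x \<in> great_arc (segment_dir n p i) (segment_dir n p (Suc i mod n))"
    unfolding great_arc_def by blast
  then have "sgn x \<in> indicatrix_curve n p"
    using assms(1) by (auto simp: indicatrix_curve_def)
  then show "sgn x \<in> indicatrix n p" "sgn (- x) \<in> indicatrix n p"
    by (auto simp: indicatrix_def sgn_minus)
qed

lemma zero_notin_sector: "cross3 \<xi> \<zeta> \<noteq> 0 \<Longrightarrow> 0 \<notin> sector \<xi> \<zeta>"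
  using sector_coordinates[of \<xi> \<zeta> 0 0] by simp

lemma flux_from_zero:
  assumes "cross3 \<xi> \<zeta> \<bullet> y \<noteq> 0"
  shows "flux \<xi> \<zeta> 0 y = 0" "flux \<xi> \<zeta> y 0 = 0"
proof -
  have "z \<notin> sector \<xi> \<zeta>" if "z \<in> closed_segment 0 y" for z
  proof
    assume z: "z \<in> sector \<xi> \<zeta>"
    from that obtain r where "z = r *\<^sub>R y" by (auto simp: in_segment)
    with sector_in_plane[OF z] assms have "z = 0" by simp
    moreover have "cross3 \<xi> \<zeta> \<noteq> 0" using assms by auto
    ultimately show False using z zero_notin_sector by blast
  qed
  then show "flux \<xi> \<zeta> 0 y = 0" by (auto simp: flux_def)
  then show "flux \<xi> \<zeta> y 0 = 0" using flux_swap[of \<xi> \<zeta> y 0] by simp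
qed

text \<open>
  For adjacent segments one corner of the difference parallelogram is the origin, and the two edges
  that do not end there lie in the cone over \<open>\<Gamma>\<^sub>i\<close> or its antipode. A path that avoids the
  indicatrix has no flux through them.
\<close>

lemma flux_in_indicatrix_cone:
  assumes avoid: "\<And>z. z \<in> sector \<xi> \<zeta> \<Longrightarrow> sgn z \<notin> indicatrix n p"
    and \<nu>: "cross3 \<xi> \<zeta> \<noteq> 0" and "i < n"
    and x: "x = a *\<^sub>R edge n p i + b *\<^sub>R edge n p (Suc i mod n)" "0 \<le> a" "0 \<le> b"
    and y: "y = c *\<^sub>R edge n p i + d *\<^sub>R edge n p (Suc i mod n)" "0 \<le> c" "0 \<le> d"
  shows "flux \<xi> \<zeta> x y = 0" "flux \<xi> \<zeta> (- x) (- y) = 0"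
proof -
  have cone: "sgn z \<in> indicatrix n p" "sgn (- z) \<in> indicatrix n p"
    if "z \<in> closed_segment x y" "z \<noteq> 0" for z
  proof -
    from that obtain r where r: "0 \<le> r" "r \<le> 1" "z = (1 - r) *\<^sub>R x + r *\<^sub>R y" by (auto simp: in_segment)
    have "z = ((1 - r) * a + r * c) *\<^sub>R edge n p i + ((1 - r) * b + r * d) *\<^sub>R edge n p (Suc i mod n)"
      by (simp add: r(3) x(1) y(1) algebra_simps)
    moreover have "0 \<le> (1 - r) * a + r * c" "0 \<le> (1 - r) * b + r * d" using r x y by simp_all
    ultimately show "sgn z \<in> indicatrix n p" "sgn (- z) \<in> indicatrix n p"
      using positive_cone_indicatrix[OF \<open>i < n\<close>] that(2) by blast+
  qed
  have "closed_segment x y \<inter> sector \<xi> \<zeta> = {}"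
    using cone(1) avoid zero_notin_sector[OF \<nu>] by blast
  then show "flux \<xi> \<zeta> x y = 0" by (simp add: flux_def)
  have "closed_segment (- x) (- y) = uminus ` closed_segment x y"
    by (simp add: closed_segment_linear_image linear_uminus)
  moreover have "- z \<notin> sector \<xi> \<zeta>" if "z \<in> closed_segment x y" for z
  proof
    assume z: "- z \<in> sector \<xi> \<zeta>"
    then have "z \<noteq> 0" using zero_notin_sector[OF \<nu>] by (metis neg_0_equal_iff_equal)
    then show False using cone(2)[OF that] avoid[OF z] by blast
  qed
  ultimately have "closed_segment (- x) (- y) \<inter> sector \<xi> \<zeta> = {}"
    by auto
  then show "flux \<xi> \<zeta> (- x) (- y) = 0" by (simp add: flux_def)
qed

lemma disjoint_segments:
  assumes dec: "decomposition K n p" and inj: "inj_on p {..<n}"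
    and ij: "i < n" "j < n" "i \<noteq> j" "j \<noteq> Suc i mod n" "i \<noteq> Suc j mod n"
  shows "segment n p i \<inter> segment n p j = {}"
proof -
  have "Suc i mod n \<noteq> Suc j mod n" using ij(1-3) by (auto simp: mod_Suc split: if_splits)
  then have "segment_ends n p i \<inter> segment_ends n p j = {}"
    using ij inj by (auto simp: segment_ends_def inj_on_eq_iff)
  then show ?thesis
    using dec ij(1-3) by (fastforce simp: decomposition_def)
qed

text \<open>
  For disjoint segments this is \<open>parallelogram_flux\<close>. For equal or adjacent segments the
  chirality is zero, and the flux vanishes because each edge of the difference parallelogram
  ends in the origin or lies in the cone over the indicatrix.
\<close>

lemma crossings_change:
  assumes dec: "decomposition K n p" and inj: "inj_on p {..<n}"
    and free: "vertex_free K n p \<xi>" "vertex_free K n p \<zeta>"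
    and generic: "\<And>k l. k < n \<Longrightarrow> l < n \<Longrightarrow> p k \<noteq> p l \<Longrightarrow> cross3 \<xi> \<zeta> \<bullet> (p k - p l) \<noteq> 0"
    and avoid: "\<And>z. z \<in> sector \<xi> \<zeta> \<Longrightarrow> sgn z \<notin> indicatrix n p"
    and ij: "i < n" "j < n"
  shows "crossing_chirality n p i j *
      (of_bool (lies_over \<xi> (segment n p i) (segment n p j)) -
       of_bool (lies_over \<zeta> (segment n p i) (segment n p j))) =
     - perimeter_flux \<xi> \<zeta> (p i - p j) (edge n p i) (- edge n p j)"
proof -
  have lt: "Suc k mod n < n" for k using ij(1) by simp
  have neq: "p k \<noteq> p (Suc k mod n)" if "k < n" for k
    using dec that by (simp add: decomposition_def)
  have \<nu>: "cross3 \<xi> \<zeta> \<noteq> 0" using generic[OF ij(1) lt neq[OF ij(1)]] by auto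
  note corners = segment_difference_corners
  have edge_flux: "flux \<xi> \<zeta> 0 (p k - p (Suc k mod n)) = 0" "flux \<xi> \<zeta> (p k - p (Suc k mod n)) 0 = 0"
      "flux \<xi> \<zeta> 0 (p (Suc k mod n) - p k) = 0" "flux \<xi> \<zeta> (p (Suc k mod n) - p k) 0 = 0" if "k < n" for k
    using flux_from_zero generic[OF that lt neq[OF that]] generic[OF lt that neq[OF that, symmetric]] by blast+
  consider (equal) "i = j" | (succ) "j = Suc i mod n" | (pred) "i = Suc j mod n"
    | (far) "i \<noteq> j" "j \<noteq> Suc i mod n" "i \<noteq> Suc j mod n" by blast
  then show ?thesis
  proof cases
    case equal
    then show ?thesis
      using edge_flux[OF ij(2)] by (simp add: equal crossing_chirality_def perimeter_flux_def edge_def)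
  next
    case succ
    let ?e = "edge n p i" and ?e' = "edge n p (Suc i mod n)"
    have eqs: "p (Suc i mod n) - p (Suc j mod n) = - ?e'" "p i - p (Suc j mod n) = - (?e + ?e')" "p i - p j = - ?e"
      by (simp_all add: edge_def succ)
    have "flux \<xi> \<zeta> (- ?e') (- (?e + ?e')) = 0" "flux \<xi> \<zeta> (- (?e + ?e')) (- ?e) = 0"
      using flux_in_indicatrix_cone(2)[OF avoid \<nu> ij(1), of ?e' 0 1 "?e + ?e'" 1 1]
        flux_in_indicatrix_cone(2)[OF avoid \<nu> ij(1), of "?e + ?e'" 1 1 ?e 1 0] by simp_all
    moreover have "flux \<xi> \<zeta> (p i - p j) 0 = 0" "flux \<xi> \<zeta> 0 (p (Suc i mod n) - p (Suc j mod n)) = 0"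
      using edge_flux[OF ij(1)] edge_flux[OF ij(2)] by (simp_all add: succ)
    moreover have "crossing_chirality n p i j = 0"
      by (simp add: crossing_chirality_def eqs(3) dot_cross_self)
    moreover have "p (Suc i mod n) - p j = 0" by (simp add: succ)
    ultimately show ?thesis
      unfolding perimeter_flux_def corners using eqs by simp
  next
    case pred
    let ?e = "edge n p j" and ?e' = "edge n p (Suc j mod n)"
    have eqs: "p (Suc i mod n) - p (Suc j mod n) = ?e'" "p (Suc i mod n) - p j = ?e + ?e'" "p i - p j = ?e"
      by (simp_all add: edge_def pred)
    have "flux \<xi> \<zeta> ?e (?e + ?e') = 0" "flux \<xi> \<zeta> (?e + ?e') ?e' = 0"
      using flux_in_indicatrix_cone(1)[OF avoid \<nu> ij(2), of ?e 1 0 "?e + ?e'" 1 1]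
        flux_in_indicatrix_cone(1)[OF avoid \<nu> ij(2), of "?e + ?e'" 1 1 ?e' 0 1] by simp_all
    moreover have "flux \<xi> \<zeta> 0 (p i - p j) = 0" "flux \<xi> \<zeta> (p (Suc i mod n) - p (Suc j mod n)) 0 = 0"
      using edge_flux[OF ij(1)] edge_flux[OF ij(2)] by (simp_all add: pred)
    moreover have "crossing_chirality n p i j = 0"
      by (simp add: crossing_chirality_def eqs(3) dot_cross_self)
    moreover have "p i - p (Suc j mod n) = 0" by (simp add: pred)
    ultimately show ?thesis
      unfolding perimeter_flux_def corners using eqs by simp
  next
    case far
    have disj: "segment n p i \<inter> segment n p j = {}"
      using disjoint_segments[OF dec inj ij far] .
    have sub: "segment n p k \<subseteq> K" if "k < n" for k
      using dec that by (auto simp: decomposition_def)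
    have ends: "p k \<in> segment n p k" "p (Suc k mod n) \<in> segment n p k" for k
      by (simp_all add: segment_def)
    have noray: "x - y \<notin> ray \<xi> \<union> ray \<zeta>"
      if "x \<in> segment n p i" "y \<in> segment n p j" "x \<in> {p i, p (Suc i mod n)} \<or> y \<in> {p j, p (Suc j mod n)}" for x y
    proof
      assume "x - y \<in> ray \<xi> \<union> ray \<zeta>"
      then obtain c \<eta> where \<eta>: "\<eta> \<in> {\<xi>, \<zeta>}" "x - y = c *\<^sub>R \<eta>" by (auto simp: ray_def)
      have free': "vertex_free K n p \<eta>" using \<eta>(1) free by auto
      have "x \<noteq> y" using that(1,2) disj by blast
      moreover have "x \<in> K" "y \<in> K" using that(1,2) sub ij by blast+
      moreover have "y - x = (- c) *\<^sub>R \<eta>" using \<eta>(2) by (simp add: algebra_simps)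
      ultimately show False
        using that(3) free' \<eta>(2) ij lt unfolding vertex_free_def by (metis insertE singletonD)
    qed
    have perimeter: "perimeter (p i - p j) (edge n p i) (- edge n p j) \<inter> (ray \<xi> \<union> ray \<zeta>) = {}"
    proof -
      have "closed_segment (p i - y) (p (Suc i mod n) - y) \<inter> (ray \<xi> \<union> ray \<zeta>) = {}"
        if "y \<in> {p j, p (Suc j mod n)}" for y
        using that noray[of _ y] ends(1,2)[of j] unfolding closed_segment_diff_left segment_def[symmetric] by blast
      moreover have "closed_segment (x - p j) (x - p (Suc j mod n)) \<inter> (ray \<xi> \<union> ray \<zeta>) = {}"
        if "x \<in> {p i, p (Suc i mod n)}" for x
        using that noray[of x] ends(1,2)[of i] unfolding closed_segment_diff_right segment_def[symmetric] by blast
      ultimately show ?thesis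
        unfolding perimeter_def corners
        by (simp add: Int_Un_distrib2 closed_segment_commute[of "p (Suc i mod n) - p (Suc j mod n)" "p i - p (Suc j mod n)"]
            closed_segment_commute[of "p i - p (Suc j mod n)" "p i - p j"])
    qed
    have pneq: "p k \<noteq> p l" if "p k \<in> segment n p i" "p l \<in> segment n p j" for k l
      using disj that by (metis disjoint_iff)
    have "0 \<notin> parallelogram (p i - p j) (edge n p i) (- edge n p j)"
      using disj unfolding difference_set_parallelogram by auto
    note flux = parallelogram_flux[OF _ _ _ _ this perimeter, unfolded corners,
        OF generic[OF ij pneq[OF ends(1) ends(1)]] generic[OF lt ij(2) pneq[OF ends(2) ends(1)]]
          generic[OF lt lt pneq[OF ends(2) ends(2)]] generic[OF ij(1) lt pneq[OF ends(1) ends(2)]]]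
    have "crossing_chirality n p i j = - sgn ((p i - p j) \<bullet> cross3 (edge n p i) (- edge n p j))"
      by (simp add: crossing_chirality_def sgn_minus)
    then show ?thesis
      using flux by (simp add: lies_over_parallelogram)
  qed
qed

text \<open>
  The sum of \<open>crossings_change\<close> over all pairs, in which the boundary fluxes cancel. The
  assumption \<open>generic\<close> keeps the corners of the difference parallelograms off the plane of the arc.
\<close>

lemma signed_crossings_generic_arc:
  assumes dec: "decomposition K n p" and inj: "inj_on p {..<n}"
    and free: "vertex_free K n p \<xi>" "vertex_free K n p \<zeta>"
    and generic: "\<And>k l. k < n \<Longrightarrow> l < n \<Longrightarrow> p k \<noteq> p l \<Longrightarrow> cross3 \<xi> \<zeta> \<bullet> (p k - p l) \<noteq> 0"
    and avoid: "\<And>z. z \<in> sector \<xi> \<zeta> \<Longrightarrow> sgn z \<notin> indicatrix n p"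
  shows "signed_crossings n p \<xi> = signed_crossings n p \<zeta>"
proof -
  have "signed_crossings n p \<xi> - signed_crossings n p \<zeta> =
    (\<Sum>i<n. \<Sum>j<n. crossing_chirality n p i j *
      (of_bool (lies_over \<xi> (segment n p i) (segment n p j)) -
       of_bool (lies_over \<zeta> (segment n p i) (segment n p j))))"
    by (simp add: signed_crossings_def sum_subtractf right_diff_distrib)
  also have "\<dots> = (\<Sum>i<n. \<Sum>j<n. - perimeter_flux \<xi> \<zeta> (p i - p j) (edge n p i) (- edge n p j))"
    using crossings_change[OF assms] by (intro sum.cong refl) auto
  also have "\<dots> = 0" by (simp add: sum_negf perimeter_flux_telescopes)
  finally show ?thesis by simp
qed

section \<open>Constancy off the indicatrix\<close>

lemma closed_great_arc: "closed (great_arc a b)"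
proof -
  have "{x. \<exists>\<alpha>\<ge>0. \<exists>\<beta>\<ge>0. x = \<alpha> *\<^sub>R a + \<beta> *\<^sub>R b} = convex_cone hull {a, b}"
  proof (intro equalityI subsetI)
    fix x assume "x \<in> {x. \<exists>\<alpha>\<ge>0. \<exists>\<beta>\<ge>0. x = \<alpha> *\<^sub>R a + \<beta> *\<^sub>R b}"
    then show "x \<in> convex_cone hull {a, b}"
      by (auto intro!: convex_cone_hull_add convex_cone_hull_mul intro: hull_inc)
  next
    fix x assume "x \<in> convex_cone hull {a, b}"
    then obtain u v c where "0 \<le> u" "0 \<le> v" "0 \<le> (c :: real)" "x = c *\<^sub>R (u *\<^sub>R a + v *\<^sub>R b)"
      by (auto simp: convex_cone_hull_convex_hull_nonempty convex_hull_2)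
    then have "x = (c * u) *\<^sub>R a + (c * v) *\<^sub>R b" "0 \<le> c * u" "0 \<le> c * v"
      by (simp_all add: scaleR_add_right)
    then show "x \<in> {x. \<exists>\<alpha>\<ge>0. \<exists>\<beta>\<ge>0. x = \<alpha> *\<^sub>R a + \<beta> *\<^sub>R b}"
      by blast
  qed
  moreover have "great_arc a b = sphere 0 1 \<inter> {x. \<exists>\<alpha>\<ge>0. \<exists>\<beta>\<ge>0. x = \<alpha> *\<^sub>R a + \<beta> *\<^sub>R b}"
    by (auto simp: great_arc_def)
  ultimately show ?thesis
    using closed_convex_cone_hull[of "{a, b}"] by (simp add: closed_Int)
qed

lemma closed_indicatrix: "closed (indicatrix n p)"
  unfolding indicatrix_def indicatrix_curve_def
  by (intro closed_Un closed_negations closed_UN) (auto simp: closed_great_arc)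

lemma exists_normal:
  obtains \<nu> :: "real^3" where "\<nu> \<noteq> 0" "\<nu> \<bullet> a = 0" "\<nu> \<bullet> b = 0"
proof -
  have "dim {a, b} \<le> card {a, b}" by (simp add: dim_le_card')
  also have "\<dots> < DIM(real^3)" by (simp add: card_insert_if)
  finally obtain \<nu> where "\<nu> \<noteq> 0" "\<And>y. y \<in> span {a, b} \<Longrightarrow> orthogonal \<nu> y"
    using orthogonal_to_subspace_exists by blast
  then show ?thesis using that by (simp add: orthogonal_def span_base)
qed

text \<open>
  Finitely many planes have measure zero and hence do not fill a ball.
\<close>

lemma direction_off_planes:
  fixes N :: "(real^3) set"
  assumes "finite N" "0 \<notin> N" "norm \<eta> = 1" "0 < r"
  obtains \<zeta> where "\<zeta> \<in> sphere 0 1 \<inter> ball \<eta> r" "\<And>\<nu>. \<nu> \<in> N \<Longrightarrow> \<nu> \<bullet> \<zeta> \<noteq> 0"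
proof -
  have "isCont sgn \<eta>" using assms(3) by (auto intro!: continuous_intros)
  then obtain d where d: "0 < d" "\<And>z. dist z \<eta> < d \<Longrightarrow> dist (sgn z) (sgn \<eta>) < r"
    using assms(4) unfolding continuous_at_eps_delta by blast
  have "negligible (\<Union>\<nu>\<in>N. {z. \<nu> \<bullet> z = 0})"
    using assms(1,2) by (intro negligible_Union) (auto intro!: negligible_hyperplane)
  moreover have "\<not> negligible (ball \<eta> (min d 1))"
    using d(1) by (intro open_not_negligible) auto
  ultimately have "\<not> ball \<eta> (min d 1) \<subseteq> (\<Union>\<nu>\<in>N. {z. \<nu> \<bullet> z = 0})"
    using negligible_subset by blast
  then obtain z where "z \<in> ball \<eta> (min d 1)" "z \<notin> (\<Union>\<nu>\<in>N. {z. \<nu> \<bullet> z = 0})"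
    by blast
  then have z: "dist z \<eta> < d" "dist z \<eta> < 1" "\<And>\<nu>. \<nu> \<in> N \<Longrightarrow> \<nu> \<bullet> z \<noteq> 0"
    by (auto simp: dist_commute)
  have "z \<noteq> 0" using z(2) assms(3) by (auto simp: dist_norm)
  moreover have "sgn \<eta> = \<eta>" using assms(3) by (simp add: sgn_div_norm)
  ultimately show ?thesis
    using that[of "sgn z"] d(2)[OF z(1)] z(3) by (simp add: norm_sgn dist_commute sgn_div_norm)
qed

lemma vertex_free_not_parallel:
  assumes "vertex_free K n p \<xi>" "norm \<xi> = 1" "k < n" "y \<in> K" "y \<noteq> p k"
  shows "cross3 (p k - y) \<xi> \<noteq> 0"
proof
  assume "cross3 (p k - y) \<xi> = 0"
  then have "(\<xi> \<bullet> \<xi>) *\<^sub>R (p k - y) - (\<xi> \<bullet> (p k - y)) *\<^sub>R \<xi> = 0"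
    using Lagrange[of \<xi> "p k - y" \<xi>] by simp
  then have "p k - y = (\<xi> \<bullet> (p k - y)) *\<^sub>R \<xi>" using assms(2) by (simp add: dot_square_norm)
  then show False using assms unfolding vertex_free_def by blast
qed

text \<open>
  A direction in which vertex \<open>k\<close> meets segment \<open>j\<close> is parallel to a plane that contains
  both, so it suffices to avoid one plane for each pair \<open>(k, j)\<close>.
\<close>

lemma vertex_free_generic:
  assumes dec: "decomposition K n p"
  obtains N where "finite N" "0 \<notin> N"
    "\<And>\<zeta>. (\<And>\<nu>. \<nu> \<in> N \<Longrightarrow> \<nu> \<bullet> \<zeta> \<noteq> 0) \<Longrightarrow> vertex_free K n p \<zeta>"
proof -
  have "\<exists>\<nu>. \<nu> \<noteq> 0 \<and> \<nu> \<bullet> (p k - p j) = 0 \<and> \<nu> \<bullet> edge n p j = 0" for k j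
    by (metis exists_normal)
  then obtain \<nu> where \<nu>: "\<And>k j. \<nu> k j \<noteq> 0" "\<And>k j. \<nu> k j \<bullet> (p k - p j) = 0" "\<And>k j. \<nu> k j \<bullet> edge n p j = 0"
    by metis
  show ?thesis
  proof (rule that[of "(\<lambda>(k, j). \<nu> k j) ` ({..<n} \<times> {..<n})"])
    fix \<zeta> assume \<zeta>: "\<And>\<mu>. \<mu> \<in> (\<lambda>(k, j). \<nu> k j) ` ({..<n} \<times> {..<n}) \<Longrightarrow> \<mu> \<bullet> \<zeta> \<noteq> 0"
    show "vertex_free K n p \<zeta>"
      unfolding vertex_free_def
    proof (intro allI ballI impI notI)
      fix k y c assume k: "k < n" "y \<in> K" "y \<noteq> p k" "p k - y = c *\<^sub>R \<zeta>"
      then obtain j where j: "j < n" "y \<in> segment n p j" using dec by (auto simp: decomposition_def)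
      then obtain s where s: "y = p j + s *\<^sub>R edge n p j" by (auto simp: in_segment_edge)
      have "c * (\<nu> k j \<bullet> \<zeta>) = \<nu> k j \<bullet> (p k - y)" by (simp add: k(4))
      also have "\<dots> = \<nu> k j \<bullet> (p k - p j) - s * (\<nu> k j \<bullet> edge n p j)"
        by (simp add: s inner_diff_right inner_add_right)
      also have "\<dots> = 0" by (simp add: \<nu>)
      finally have "c = 0" using \<zeta> k(1) j(1) by auto
      then show False using k(3,4) by simp
    qed
  qed (use \<nu>(1) in auto)
qed

text \<open>
  Two directions \<open>\<xi>\<close> and \<open>\<xi>'\<close> near \<open>\<eta>\<close> are joined by two arcs through a third direction \<open>\<zeta>\<close> near \<open>\<eta>\<close>.
  Choosing \<open>\<zeta>\<close> off finitely many planes makes both arcs generic. The point \<open>\<eta>\<close>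
  itself may be as degenerate as it likes, as long as it is not on the indicatrix.
\<close>

lemma signed_crossings_locally_constant:
  assumes dec: "decomposition K n p" and inj: "inj_on p {..<n}"
    and \<eta>: "\<eta> \<in> sphere 0 1 - indicatrix n p"
  obtains r c where "0 < r"
    "\<And>\<xi>. \<xi> \<in> sphere 0 1 \<inter> ball \<eta> r \<Longrightarrow> vertex_free K n p \<xi> \<Longrightarrow> signed_crossings n p \<xi> = c"
proof -
  have "norm \<eta> = 1" using \<eta> by simp
  have "open {z \<in> - {0}. sgn z \<in> - indicatrix n p}"
    using closed_indicatrix[of n p]
    by (intro continuous_open_preimage[of "- {0}" sgn, unfolded vimage_def Int_def mem_Collect_eq] continuous_intros)
      (auto simp: open_Compl)
  moreover have "\<eta> \<in> {z \<in> - {0}. sgn z \<in> - indicatrix n p}"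
    using \<eta> by (auto simp: sgn_div_norm)
  ultimately obtain r where r: "0 < r" "ball \<eta> r \<subseteq> {z \<in> - {0}. sgn z \<in> - indicatrix n p}"
    using open_contains_ball by blast
  have avoid: "sgn z \<notin> indicatrix n p" if in_ball: "\<xi> \<in> ball \<eta> r" "\<zeta> \<in> ball \<eta> r" and z: "z \<in> sector \<xi> \<zeta>" for \<xi> \<zeta> z
  proof -
    obtain a b where ab: "0 < a" "0 < b" "z = a *\<^sub>R \<xi> + b *\<^sub>R \<zeta>" using z by (auto simp: sector_def)
    let ?z = "(a / (a + b)) *\<^sub>R \<xi> + (b / (a + b)) *\<^sub>R \<zeta>"
    have "?z \<in> ball \<eta> r"
    proof (rule convexD[OF convex_ball in_ball])
      show "a / (a + b) + b / (a + b) = 1"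
        using ab by (simp flip: add_divide_distrib)
    qed (use ab in simp_all)
    moreover have "z = (a + b) *\<^sub>R ?z" using ab by (simp add: scaleR_add_right)
    then have "sgn z = sgn (a + b) *\<^sub>R sgn ?z" by (metis sgn_scaleR)
    then have "sgn z = sgn ?z" using ab by simp
    ultimately show ?thesis using r(2) by auto
  qed
  obtain N where N: "finite N" "0 \<notin> N"
    "\<And>\<zeta>. (\<And>\<nu>. \<nu> \<in> N \<Longrightarrow> \<nu> \<bullet> \<zeta> \<noteq> 0) \<Longrightarrow> vertex_free K n p \<zeta>"
    using vertex_free_generic[OF dec] by blast
  have pK: "p k \<in> K" if "k < n" for k
    using dec that by (auto simp: decomposition_def segment_def)
  \<comment> \<open>The normals of the planes through \<open>\<xi>\<close> and a difference of two vertices.\<close>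
  define M where "M \<xi> = (\<lambda>(k, l). cross3 (p k - p l) \<xi>) ` {(k, l). k < n \<and> l < n \<and> p k \<noteq> p l}" for \<xi>
  have finM: "finite (M \<xi>)" for \<xi>
    unfolding M_def by (rule finite_imageI, rule finite_subset[of _ "{..<n} \<times> {..<n}"]) auto
  have M0: "0 \<notin> M \<xi>" if "vertex_free K n p \<xi>" "norm \<xi> = 1" for \<xi>
    unfolding M_def using vertex_free_not_parallel[OF that] pK by fastforce
  have eq: "signed_crossings n p \<xi> = signed_crossings n p \<zeta>"
    if "\<xi> \<in> ball \<eta> r" "\<zeta> \<in> ball \<eta> r" "vertex_free K n p \<xi>" "vertex_free K n p \<zeta>"
      "\<And>\<mu>. \<mu> \<in> M \<xi> \<Longrightarrow> \<mu> \<bullet> \<zeta> \<noteq> 0" for \<xi> \<zeta>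
  proof (rule signed_crossings_generic_arc[OF dec inj that(3,4)])
    fix k l assume kl: "k < n" "l < n" "p k \<noteq> p l"
    have "cross3 \<xi> \<zeta> \<bullet> (p k - p l) = cross3 (p k - p l) \<xi> \<bullet> \<zeta>"
      by (simp add: cross_triple)
    then show "cross3 \<xi> \<zeta> \<bullet> (p k - p l) \<noteq> 0"
      using that(5) kl by (auto simp: M_def)
  qed (use avoid that(1,2) in blast)
  have const: "signed_crossings n p \<xi> = signed_crossings n p \<xi>'"
    if \<xi>: "\<xi> \<in> sphere 0 1 \<inter> ball \<eta> r" "vertex_free K n p \<xi>" "\<xi>' \<in> sphere 0 1 \<inter> ball \<eta> r" "vertex_free K n p \<xi>'"
    for \<xi> \<xi>'
  proof -
    obtain \<zeta> where \<zeta>: "\<zeta> \<in> sphere 0 1 \<inter> ball \<eta> r" "\<And>\<nu>. \<nu> \<in> N \<union> M \<xi> \<union> M \<xi>' \<Longrightarrow> \<nu> \<bullet> \<zeta> \<noteq> 0"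
    proof (rule direction_off_planes[OF _ _ \<open>norm \<eta> = 1\<close> r(1)])
      show "finite (N \<union> M \<xi> \<union> M \<xi>')" using N(1) finM by simp
      show "0 \<notin> N \<union> M \<xi> \<union> M \<xi>'" using N(2) M0 \<xi> by simp
    qed blast
    have "vertex_free K n p \<zeta>" using N(3) \<zeta>(2) by blast
    then show ?thesis using eq[of \<xi> \<zeta>] eq[of \<xi>' \<zeta>] \<xi> \<zeta> by simp
  qed
  show ?thesis
  proof (cases "\<exists>\<xi>\<^sub>0 \<in> sphere 0 1 \<inter> ball \<eta> r. vertex_free K n p \<xi>\<^sub>0")
    case True
    then show ?thesis using that[OF r(1)] const by blast
  next
    case False
    then show ?thesis using that[OF r(1)] by blast
  qed
qed

text \<open>
  A path in the component may pass through directions that are not vertex free. Each point of the component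
  therefore carries the value \<open>c\<close> taken at all vertex free directions near it; by density this
  value is unique, and it is locally constant.
\<close>

lemma signed_crossings_constant_on_component:
  assumes dec: "decomposition K n p" and inj: "inj_on p {..<n}"
    and C: "connected_component (sphere 0 1 - indicatrix n p) \<xi> \<xi>'"
    and free: "vertex_free K n p \<xi>" "vertex_free K n p \<xi>'"
  shows "signed_crossings n p \<xi> = signed_crossings n p \<xi>'"
proof -
  obtain T where T: "connected T" "T \<subseteq> sphere 0 1 - indicatrix n p" "\<xi> \<in> T" "\<xi>' \<in> T"
    using C unfolding connected_component_def by blast
  define near where "near \<eta> c \<longleftrightarrow> (\<exists>r>0. \<forall>\<zeta>\<in>sphere 0 1 \<inter> ball \<eta> r. vertex_free K n p \<zeta> \<longrightarrow>
      signed_crossings n p \<zeta> = c)" for \<eta> c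
  obtain N where N: "finite N" "0 \<notin> N"
    "\<And>\<zeta>. (\<And>\<nu>. \<nu> \<in> N \<Longrightarrow> \<nu> \<bullet> \<zeta> \<noteq> 0) \<Longrightarrow> vertex_free K n p \<zeta>"
    using vertex_free_generic[OF dec] by blast
  have unique: "c = c'" if "near \<eta> c" "near \<eta> c'" "\<eta> \<in> T" for \<eta> c c'
  proof -
    obtain r r' where r: "0 < r" "\<forall>\<zeta>\<in>sphere 0 1 \<inter> ball \<eta> r. vertex_free K n p \<zeta> \<longrightarrow> signed_crossings n p \<zeta> = c"
       "0 < r'" "\<forall>\<zeta>\<in>sphere 0 1 \<inter> ball \<eta> r'. vertex_free K n p \<zeta> \<longrightarrow> signed_crossings n p \<zeta> = c'"
      using \<open>near \<eta> c\<close> \<open>near \<eta> c'\<close> unfolding near_def by blast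
    have "norm \<eta> = 1" "0 < min r r'" using that(3) T(2) r(1,3) by auto
    then obtain \<zeta> where "\<zeta> \<in> sphere 0 1 \<inter> ball \<eta> (min r r')" "\<And>\<nu>. \<nu> \<in> N \<Longrightarrow> \<nu> \<bullet> \<zeta> \<noteq> 0"
      using direction_off_planes[OF N(1,2)] by blast
    then show ?thesis using r(2,4) N(3)[of \<zeta>] by auto
  qed
  have "\<exists>c. near \<xi> c \<and> near \<xi>' c"
  proof (rule connected_equivalence_relation[OF T(1,3,4)])
    show "\<exists>c. near x c \<and> near z c" if "\<exists>c. near x c \<and> near y c" "\<exists>c. near y c \<and> near z c" "y \<in> T" for x y z
      using that unique by blast
  next
    fix \<eta> assume "\<eta> \<in> T"
    then have \<eta>: "\<eta> \<in> sphere 0 1 - indicatrix n p" using T(2) by blast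
    obtain r c where r: "0 < r" "\<And>\<xi>. \<xi> \<in> sphere 0 1 \<inter> ball \<eta> r \<Longrightarrow> vertex_free K n p \<xi> \<Longrightarrow> signed_crossings n p \<xi> = c"
      using signed_crossings_locally_constant[OF dec inj \<eta>] by blast
    have "near x c" if "x \<in> ball \<eta> r" for x
    proof -
      have "ball x (r - dist \<eta> x) \<subseteq> ball \<eta> r"
      proof
        fix z assume "z \<in> ball x (r - dist \<eta> x)"
        then show "z \<in> ball \<eta> r"
          using dist_triangle[of \<eta> z x] by simp
      qed
      moreover have "0 < r - dist \<eta> x" using that by simp
      ultimately show ?thesis unfolding near_def using r(2) by blast
    qed
    then have "\<forall>x\<in>T \<inter> ball \<eta> r. near \<eta> c \<and> near x c"
      using r(1) by simp
    then show "\<exists>U. openin (top_of_set T) U \<and> \<eta> \<in> U \<and> (\<forall>x\<in>U. \<exists>c. near \<eta> c \<and> near x c)"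
      using \<open>\<eta> \<in> T\<close> r(1)
      by (intro exI[of _ "T \<inter> ball \<eta> r"] conjI) (blast, simp, blast)
  qed blast
  then obtain c where "near \<xi> c" "near \<xi>' c" by blast
  moreover have "\<xi> \<in> sphere 0 1" "\<xi>' \<in> sphere 0 1" using T by blast+
  ultimately show ?thesis
    using free unfolding near_def by (metis IntI centre_in_ball)
qed

section \<open>The Tait number as a count of signed crossings\<close>

lemma orth_proj_eq_iff:
  assumes "norm \<xi> = 1"
  shows "orth_proj \<xi> x = orth_proj \<xi> y \<longleftrightarrow> (\<exists>c. x - y = c *\<^sub>R \<xi>)"
proof
  assume "orth_proj \<xi> x = orth_proj \<xi> y"
  then have "x - y = ((x - y) \<bullet> \<xi>) *\<^sub>R \<xi>"
    by (simp add: orth_proj_def algebra_simps)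
  then show "\<exists>c. x - y = c *\<^sub>R \<xi>" by blast
next
  assume "\<exists>c. x - y = c *\<^sub>R \<xi>"
  then obtain c where "x = y + c *\<^sub>R \<xi>" by (auto simp: algebra_simps)
  moreover have "\<xi> \<bullet> \<xi> = 1" using assms by (simp add: dot_square_norm)
  ultimately show "orth_proj \<xi> x = orth_proj \<xi> y"
    by (simp add: orth_proj_def algebra_simps)
qed

lemma orth_proj_in_plane: "norm \<xi> = 1 \<Longrightarrow> orth_proj \<xi> x \<in> orth_plane \<xi>"
  by (simp add: orth_plane_def orth_proj_def inner_diff_left dot_square_norm)

lemma vertex_not_interior: "k < n \<Longrightarrow> p k \<notin> interior_points K n p"
  by (auto simp: interior_points_def vertices_def)

lemma good_projection_vertex_free:
  assumes dec: "decomposition K n p" and \<xi>: "norm \<xi> = 1" and good: "good_projection K n p \<xi>"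
  shows "vertex_free K n p \<xi>"
  unfolding vertex_free_def
proof (intro allI ballI impI notI)
  fix k y c assume k: "k < n" "y \<in> K" "y \<noteq> p k" "p k - y = c *\<^sub>R \<xi>"
  let ?v = "orth_proj \<xi> (p k)"
  have "p k \<in> K" using dec k(1) by (auto simp: decomposition_def segment_def)
  moreover have "orth_proj \<xi> y = ?v" using orth_proj_eq_iff[OF \<xi>] k(4) by metis
  ultimately have "{p k, y} \<subseteq> fibre K \<xi> ?v" using k(2) by (simp add: fibre_def)
  moreover have "fibre K \<xi> ?v = {} \<or> (\<exists>x. fibre K \<xi> ?v = {x}) \<or>
      (\<exists>x y. x \<noteq> y \<and> x \<in> interior_points K n p \<and> y \<in> interior_points K n p \<and> fibre K \<xi> ?v = {x, y})"
    using good orth_proj_in_plane[OF \<xi>] by (simp add: good_projection_def)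
  ultimately show False using k(3) vertex_not_interior[OF k(1), of p K] by auto
qed

lemma interior_point_segment_unique:
  assumes dec: "decomposition K n p" and x: "x \<in> interior_points K n p" "i < n" "x \<in> segment n p i"
  shows "(THE i. i < n \<and> x \<in> segment n p i) = i"
proof (rule the_equality)
  fix j assume j: "j < n \<and> x \<in> segment n p j"
  show "j = i"
  proof (rule ccontr)
    assume "j \<noteq> i"
    then have "x \<in> segment_ends n p i" using dec x j by (fastforce simp: decomposition_def)
    then have "x \<in> vertices n p" using x(2) by (auto simp: segment_ends_def vertices_def)
    then show False using x(1) by (simp add: interior_points_def)
  qed
qed (use x in simp)

lemma good_crossing:
  assumes \<xi>: "norm \<xi> = 1" and good: "good_projection K n p \<xi>"
    and xy: "x \<in> K" "y \<in> K" "x - y = c *\<^sub>R \<xi>" "0 < c"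
  defines "v \<equiv> orth_proj \<xi> x"
  shows "x \<in> interior_points K n p" "y \<in> interior_points K n p" "v \<in> double_points K \<xi>"
    "upper_point K \<xi> v = x" "lower_point K \<xi> v = y"
proof -
  have \<xi>\<xi>: "\<xi> \<bullet> \<xi> = 1" using \<xi> by (simp add: dot_square_norm)
  have neq: "x \<noteq> y" using xy(3,4) \<xi> by auto
  have "(x - y) \<bullet> \<xi> = c" using \<xi>\<xi> by (simp add: xy(3))
  then have less: "y \<bullet> \<xi> < x \<bullet> \<xi>" using xy(4) by (simp add: inner_diff_left)
  have plane: "v \<in> orth_plane \<xi>" using orth_proj_in_plane[OF \<xi>] by (simp add: v_def)
  have "{x, y} \<subseteq> fibre K \<xi> v" using xy orth_proj_eq_iff[OF \<xi>, of x y] by (auto simp: fibre_def v_def)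
  moreover have "fibre K \<xi> v = {} \<or> (\<exists>x. fibre K \<xi> v = {x}) \<or>
      (\<exists>x y. x \<noteq> y \<and> x \<in> interior_points K n p \<and> y \<in> interior_points K n p \<and> fibre K \<xi> v = {x, y})"
    using good plane by (simp add: good_projection_def)
  ultimately obtain x' y' where xy': "x' \<in> interior_points K n p" "y' \<in> interior_points K n p"
      "fibre K \<xi> v = {x', y'}"
    using neq by auto
  with \<open>{x, y} \<subseteq> fibre K \<xi> v\<close> neq have fib: "fibre K \<xi> v = {x, y}" by auto
  show "x \<in> interior_points K n p" "y \<in> interior_points K n p"
    using xy' fib by (auto simp: doubleton_eq_iff)
  show "v \<in> double_points K \<xi>" using plane fib neq by (simp add: double_points_def)
  show "upper_point K \<xi> v = x"
    unfolding upper_point_def fib by (rule the_equality) (use less in force)+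
  show "lower_point K \<xi> v = y"
    unfolding lower_point_def fib by (rule the_equality) (use less in force)+
qed

lemma double_point_strands:
  assumes \<xi>: "norm \<xi> = 1" and v: "v \<in> double_points K \<xi>"
  obtains x y c where "x \<in> K" "y \<in> K" "x - y = c *\<^sub>R \<xi>" "0 < c" "v = orth_proj \<xi> x"
proof -
  obtain a b where ab: "fibre K \<xi> v = {a, b}" "a \<noteq> b"
    using v by (auto simp: double_points_def card_2_iff)
  then have K: "a \<in> K" "b \<in> K" "orth_proj \<xi> a = v" "orth_proj \<xi> b = v"
    unfolding fibre_def by blast+
  then obtain c where c: "a - b = c *\<^sub>R \<xi>" using orth_proj_eq_iff[OF \<xi>] by metis
  then have "c \<noteq> 0" using ab(2) by auto
  then show ?thesis
    using that[of a b c] that[of b a "- c"] c K by (cases "0 < c") (auto simp: algebra_simps)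
qed

lemma exit_unit_interval:
  fixes s a :: real
  assumes "0 < s" "s < 1" "a \<noteq> 0"
  obtains \<rho> where "0 < \<rho>" "s + \<rho> * a \<in> {0, 1}" "\<And>r. r \<in> {0..\<rho>} \<Longrightarrow> s + r * a \<in> {0..1}"
proof (cases "0 < a")
  case True
  show ?thesis
  proof (rule that[of "(1 - s) / a"])
    fix r assume "r \<in> {0..(1 - s) / a}"
    then have "0 \<le> r * a" "r * a \<le> 1 - s" using True by (auto simp: field_simps)
    then show "s + r * a \<in> {0..1}" using assms by auto
  qed (use True assms in auto)
next
  case False
  then have a: "a < 0" using assms by simp
  show ?thesis
  proof (rule that[of "s / (- a)"])
    fix r assume "r \<in> {0..s / (- a)}"
    then have "0 \<le> r * (- a)" "r * (- a) \<le> s" using a by (auto simp: field_simps mult_nonneg_nonpos mult_nonpos_nonneg)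
    then show "s + r * a \<in> {0..1}" using assms by auto
  qed (use a assms in \<open>auto simp: divide_pos_neg\<close>)
qed

lemma exit_unit_square:
  fixes s t a b :: real
  assumes "0 < s" "s < 1" "0 < t" "t < 1" "a \<noteq> 0 \<or> b \<noteq> 0"
  obtains r where "0 < r" "s + r * a \<in> {0..1}" "t + r * b \<in> {0..1}" "s + r * a \<in> {0, 1} \<or> t + r * b \<in> {0, 1}"
proof (cases "a = 0 \<or> b = 0")
  case True
  then show ?thesis
  proof
    assume "a = 0"
    with assms(5) have "b \<noteq> 0" by simp
    then obtain \<rho> where "0 < \<rho>" "t + \<rho> * b \<in> {0, 1}"
      using exit_unit_interval[OF assms(3,4)] by metis
    then show ?thesis using that[of \<rho>] \<open>a = 0\<close> assms by auto
  next
    assume "b = 0"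
    with assms(5) have "a \<noteq> 0" by simp
    then obtain \<rho> where "0 < \<rho>" "s + \<rho> * a \<in> {0, 1}"
      using exit_unit_interval[OF assms(1,2)] by metis
    then show ?thesis using that[of \<rho>] \<open>b = 0\<close> assms by auto
  qed
next
  case False
  obtain \<rho> where \<rho>: "0 < \<rho>" "s + \<rho> * a \<in> {0, 1}" "\<And>r. r \<in> {0..\<rho>} \<Longrightarrow> s + r * a \<in> {0..1}"
    using exit_unit_interval[OF assms(1,2)] False by metis
  obtain \<sigma> where \<sigma>: "0 < \<sigma>" "t + \<sigma> * b \<in> {0, 1}" "\<And>r. r \<in> {0..\<sigma>} \<Longrightarrow> t + r * b \<in> {0..1}"
    using exit_unit_interval[OF assms(3,4)] False by metis
  show ?thesis
    using that[of "min \<rho> \<sigma>"] \<rho>(1,2) \<sigma>(1,2) \<rho>(3)[of "min \<rho> \<sigma>"] \<sigma>(3)[of "min \<rho> \<sigma>"]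
    by (auto simp: min_def split: if_splits)
qed

text \<open>
  If the chirality of a crossing were zero, its two strands would project into one line, and the
  points \<open>x\<close> and \<open>y\<close> could slide along their segments while staying on a common line parallel to
  \<open>\<xi>\<close>. Sliding in either direction until one of them reaches a vertex, the two must meet there,
  as no vertex is covered by another point. But their height difference changes
  linearly and is positive at the start, so it cannot vanish on both sides.
\<close>

lemma good_crossing_transversal:
  assumes dec: "decomposition K n p" and \<xi>: "norm \<xi> = 1" and free: "vertex_free K n p \<xi>"
    and ij: "i < n" "j < n" and xy: "x \<in> segment n p i" "y \<in> segment n p j" "x - y = c *\<^sub>R \<xi>" "0 < c"
    and int: "x \<in> interior_points K n p" "y \<in> interior_points K n p"
  shows "crossing_chirality n p i j \<noteq> 0"
proof
  let ?e = "edge n p i" and ?e' = "edge n p j"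
  assume "crossing_chirality n p i j = 0"
  then have chi: "(p i - p j) \<bullet> cross3 ?e ?e' = 0" by (simp add: crossing_chirality_def sgn_0_0)
  obtain s t where st: "s \<in> {0..1}" "x = p i + s *\<^sub>R ?e" "t \<in> {0..1}" "y = p j + t *\<^sub>R ?e'"
    using xy(1,2) by (auto simp: in_segment_edge)
  have lt: "Suc k mod n < n" for k using ij(1) by simp
  have next_vertex: "p k + edge n p k = p (Suc k mod n)" for k by (simp add: edge_def)
  have "s \<noteq> 0" "s \<noteq> 1" "t \<noteq> 0" "t \<noteq> 1"
    using int st vertex_not_interior[OF ij(1), of p K] vertex_not_interior[OF ij(2), of p K]
      vertex_not_interior[OF lt[of i], of p K] vertex_not_interior[OF lt[of j], of p K] by (auto simp: next_vertex)
  then have st01: "0 < s" "s < 1" "0 < t" "t < 1" using st(1,3) by auto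
  have "(x - y) \<bullet> cross3 ?e ?e' = (p i - p j) \<bullet> cross3 ?e ?e'"
    by (simp add: st(2,4) inner_diff_left inner_add_left dot_cross_self)
  then have perp: "cross3 ?e ?e' \<bullet> \<xi> = 0" using chi xy(3,4) by (simp add: inner_commute)
  obtain a b g where dep: "a *\<^sub>R ?e + b *\<^sub>R ?e' = g *\<^sub>R \<xi>" "a \<noteq> 0 \<or> b \<noteq> 0"
  proof (cases "cross3 ?e ?e' = 0")
    case True
    then have "(?e \<bullet> ?e') *\<^sub>R ?e + (- (?e \<bullet> ?e)) *\<^sub>R ?e' = 0 *\<^sub>R \<xi>"
      using Lagrange[of ?e ?e ?e'] by simp
    moreover have "?e \<noteq> 0" using dec ij(1) by (auto simp: decomposition_def edge_def)
    ultimately show ?thesis using that by (metis inner_eq_zero_iff neg_equal_0_iff_equal)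
  next
    case False
    then obtain a b where "\<xi> = a *\<^sub>R ?e + b *\<^sub>R ?e'" using plane_coordinates perp by blast
    moreover from this have "a \<noteq> 0 \<or> b \<noteq> 0" using \<xi> by auto
    ultimately show ?thesis using that[of a b 1] by simp
  qed
  have K: "z \<in> K" if "z \<in> segment n p i \<or> z \<in> segment n p j" for z
    using dec ij that by (auto simp: decomposition_def)
  \<comment> \<open>Moving \<open>x\<close> with velocity \<open>a e\<close> and \<open>y\<close> with velocity \<open>- b e'\<close>, where \<open>e\<close> and \<open>e'\<close> are the two
      edges, changes the height difference \<open>c\<close> at the rate \<open>g\<close>.\<close>
  have slide: "\<exists>r>0. c + r * g = 0" if dep: "a *\<^sub>R ?e + b *\<^sub>R ?e' = g *\<^sub>R \<xi>" "a \<noteq> 0 \<or> b \<noteq> 0" for a b g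
  proof -
    obtain r where r: "0 < r" "s + r * a \<in> {0..1}" "t + r * (- b) \<in> {0..1}"
        "s + r * a \<in> {0, 1} \<or> t + r * (- b) \<in> {0, 1}"
      using exit_unit_square[OF st01, of a "- b"] dep(2) by auto
    define x' where "x' = p i + (s + r * a) *\<^sub>R ?e"
    define y' where "y' = p j + (t + r * (- b)) *\<^sub>R ?e'"
    have "x' - y' = (x - y) + r *\<^sub>R (a *\<^sub>R ?e + b *\<^sub>R ?e')"
      by (simp add: x'_def y'_def st(2,4) algebra_simps)
    then have diff: "x' - y' = (c + r * g) *\<^sub>R \<xi>" "y' - x' = (- (c + r * g)) *\<^sub>R \<xi>"
      by (simp_all add: xy(3) dep(1) algebra_simps)
    have in_K: "x' \<in> K" "y' \<in> K"
      using K r(2,3) unfolding x'_def y'_def Bex_def in_segment_edge by blast+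
    have "x' = p i \<or> x' = p (Suc i mod n) \<or> y' = p j \<or> y' = p (Suc j mod n)"
      using r(4) by (auto simp: x'_def y'_def next_vertex)
    then have "(\<exists>k<n. x' = p k) \<or> (\<exists>k<n. y' = p k)"
      using ij lt[of i] lt[of j] by metis
    then have "x' = y'"
      using free in_K diff unfolding vertex_free_def by metis
    then have "c + r * g = 0" using diff(1) \<xi> by auto
    then show ?thesis using r(1) by blast
  qed
  obtain r where "0 < r" "c + r * g = 0" using slide[OF dep] by blast
  moreover obtain r' where "0 < r'" "c + r' * (- g) = 0"
    using slide[of "- a" "- b" "- g"] dep by (auto simp: neg_eq_iff_add_eq_0 algebra_simps)
  ultimately have "r * g < 0" "0 < r' * g" using xy(4) by simp_all
  then show False using \<open>0 < r\<close> \<open>0 < r'\<close> by (simp add: zero_less_mult_iff mult_less_0_iff)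
qed

text \<open>
  Write \<open>w\<close> in the orthogonal basis \<open>u\<close>, \<open>\<xi> \<times> u\<close> and pass to polar coordinates: the angle lies strictly
  between \<open>0\<close> and \<open>\<pi>\<close> exactly if the second coordinate is positive.
\<close>

lemma rotation_exists_iff:
  assumes \<xi>: "norm \<xi> = 1" and uw: "u \<in> orth_plane \<xi>" "w \<in> orth_plane \<xi>" "u \<noteq> 0"
  shows "(\<exists>\<theta>. 0 < \<theta> \<and> \<theta> < pi \<and> (\<exists>c>0. w = c *\<^sub>R rotate_ccw \<xi> \<theta> u)) \<longleftrightarrow> 0 < \<xi> \<bullet> cross3 u w"
proof -
  have \<xi>\<xi>: "\<xi> \<bullet> \<xi> = 1" using \<xi> by (simp add: dot_square_norm)
  have perp: "u \<bullet> \<xi> = 0" "w \<bullet> \<xi> = 0" using uw by (simp_all add: orth_plane_def)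
  have basis: "cross3 u (cross3 \<xi> u) = (u \<bullet> u) *\<^sub>R \<xi>" using perp by (simp add: Lagrange)
  have turn: "\<xi> \<bullet> cross3 u (a *\<^sub>R u + b *\<^sub>R cross3 \<xi> u) = b * (u \<bullet> u)" for a b
    by (simp add: cross_add_right cross_mult_right basis \<xi>\<xi>)
  have uu: "0 < u \<bullet> u" using uw(3) by simp
  show ?thesis
  proof
    assume "\<exists>\<theta>. 0 < \<theta> \<and> \<theta> < pi \<and> (\<exists>c>0. w = c *\<^sub>R rotate_ccw \<xi> \<theta> u)"
    then obtain \<theta> c where c: "0 < \<theta>" "\<theta> < pi" "0 < c" "w = (c * cos \<theta>) *\<^sub>R u + (c * sin \<theta>) *\<^sub>R cross3 \<xi> u"
      by (auto simp: rotate_ccw_def scaleR_add_right)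
    then show "0 < \<xi> \<bullet> cross3 u w" using uu by (simp add: turn sin_gt_zero)
  next
    assume pos: "0 < \<xi> \<bullet> cross3 u w"
    have "cross3 u (cross3 \<xi> u) \<noteq> 0" "cross3 u (cross3 \<xi> u) \<bullet> w = 0"
      using uu \<xi> perp by (auto simp: basis inner_commute)
    then obtain a b where w: "w = a *\<^sub>R u + b *\<^sub>R cross3 \<xi> u" using plane_coordinates by blast
    then have b: "0 < b" using pos uu turn by (simp add: zero_less_mult_iff)
    define c where "c = sqrt (a\<^sup>2 + b\<^sup>2)"
    have c: "0 < c" "c\<^sup>2 = a\<^sup>2 + b\<^sup>2" using b by (auto simp: c_def intro: add_nonneg_pos)
    have "(a / c)\<^sup>2 + (b / c)\<^sup>2 = 1" "0 \<le> b / c"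
      using b c by (simp_all add: power_divide flip: add_divide_distrib)
    then obtain \<theta> where \<theta>: "0 \<le> \<theta>" "\<theta> \<le> pi" "a / c = cos \<theta>" "b / c = sin \<theta>"
      using sincos_total_pi by blast
    have "sin \<theta> \<noteq> 0" using \<theta>(4) b c(1) by auto
    then have "0 < \<theta>" "\<theta> < pi" using \<theta>(1,2) by (auto simp: order_le_less)
    moreover have "w = c *\<^sub>R rotate_ccw \<xi> \<theta> u"
      using c(1) by (simp add: w rotate_ccw_def scaleR_add_right flip: \<theta>(3,4))
    ultimately show "\<exists>\<theta>. 0 < \<theta> \<and> \<theta> < pi \<and> (\<exists>c>0. w = c *\<^sub>R rotate_ccw \<xi> \<theta> u)" using c(1) by blast
  qed
qed

text \<open>
  The crossing sign is the sign of \<open>\<xi> \<bullet> (s\<^sub>i \<times> s\<^sub>j)\<close> for the unit directions of the upper and lower segments;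
  since the upper point minus the lower point is a positive multiple of \<open>\<xi>\<close>, the vector \<open>\<xi>\<close> can be replaced
  in this triple product by \<open>p i - p j\<close>.
\<close>

lemma crossing_sign_eq_chirality:
  assumes dec: "decomposition K n p" and \<xi>: "norm \<xi> = 1" and good: "good_projection K n p \<xi>"
    and ij: "i < n" "j < n" and xy: "x \<in> segment n p i" "y \<in> segment n p j" "x - y = c *\<^sub>R \<xi>" "0 < c"
  shows "of_int (crossing_sign K n p \<xi> (orth_proj \<xi> x)) = crossing_chirality n p i j"
    and "crossing_chirality n p i j \<noteq> 0"
proof -
  have K: "x \<in> K" "y \<in> K" using dec ij xy by (auto simp: decomposition_def)
  note crossing = good_crossing[OF \<xi> good K xy(3,4)]
  let ?e = "edge n p i" and ?e' = "edge n p j"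
  let ?d = "segment_dir n p i" and ?d' = "segment_dir n p j"
  show nz: "crossing_chirality n p i j \<noteq> 0"
    using good_crossing_transversal[OF dec \<xi> good_projection_vertex_free[OF dec \<xi> good] ij xy crossing(1,2)] .
  have dirs: "strand_dir n p x = ?d" "strand_dir n p y = ?d'"
    using interior_point_segment_unique[OF dec crossing(1) ij(1) xy(1)]
      interior_point_segment_unique[OF dec crossing(2) ij(2) xy(2)] by (simp_all add: strand_dir_def)
  obtain s t where st: "x = p i + s *\<^sub>R ?e" "y = p j + t *\<^sub>R ?e'"
    using xy(1,2) by (auto simp: in_segment_edge)
  have "(x - y) \<bullet> cross3 ?e ?e' = (p i - p j) \<bullet> cross3 ?e ?e'"
    by (simp add: st inner_diff_left inner_add_left dot_cross_self)
  then have "crossing_chirality n p i j = sgn (c * (\<xi> \<bullet> cross3 ?e ?e'))"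
    by (simp add: crossing_chirality_def xy(3))
  then have chi: "crossing_chirality n p i j = sgn (\<xi> \<bullet> cross3 ?e ?e')"
    using xy(4) by (simp add: sgn_mult)
  let ?u = "orth_proj \<xi> ?d" and ?w = "orth_proj \<xi> ?d'"
  have "\<xi> \<bullet> cross3 ?u ?w = \<xi> \<bullet> cross3 ?d ?d'"
    by (simp add: orth_proj_def Cross3.left_diff_distrib Cross3.right_diff_distrib cross_mult_left cross_mult_right
        inner_diff_right dot_cross_self)
  also have "\<dots> = (inverse (norm ?e) * inverse (norm ?e')) * (\<xi> \<bullet> cross3 ?e ?e')"
    by (simp add: segment_dir_def sgn_div_norm cross_mult_left cross_mult_right flip: edge_def)
  finally have "sgn (\<xi> \<bullet> cross3 ?u ?w) = sgn (inverse (norm ?e) * inverse (norm ?e')) * crossing_chirality n p i j"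
    unfolding chi by (simp add: sgn_mult)
  moreover have "?e \<noteq> 0" "?e' \<noteq> 0" using dec ij by (auto simp: decomposition_def edge_def)
  ultimately have sgn_uw: "sgn (\<xi> \<bullet> cross3 ?u ?w) = crossing_chirality n p i j" by (simp add: sgn_mult)
  then have "?u \<noteq> 0" using nz by auto
  then have "crossing_sign K n p \<xi> (orth_proj \<xi> x) = (if 0 < \<xi> \<bullet> cross3 ?u ?w then 1 else - 1)"
    using rotation_exists_iff[OF \<xi> orth_proj_in_plane[OF \<xi>] orth_proj_in_plane[OF \<xi>], of ?d ?d']
    by (simp add: crossing_sign_def crossing(4,5) dirs)
  then show "of_int (crossing_sign K n p \<xi> (orth_proj \<xi> x)) = crossing_chirality n p i j"
    using sgn_uw nz by (auto simp: sgn_if split: if_splits)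
qed

text \<open>
  The difference parallelogram lies in a plane that misses the origin, so the line along \<open>\<xi>\<close> meets it
  at most once.
\<close>

lemma skew_crossing_unique:
  assumes nz: "crossing_chirality n p i j \<noteq> 0"
    and xy: "x \<in> segment n p i" "y \<in> segment n p j" "x - y = c *\<^sub>R \<xi>"
    and xy': "x' \<in> segment n p i" "y' \<in> segment n p j" "x' - y' = c' *\<^sub>R \<xi>"
  shows "x = x'"
proof -
  let ?e = "edge n p i" and ?e' = "edge n p j"
  have chi: "(p i - p j) \<bullet> cross3 ?e ?e' \<noteq> 0" using nz by (auto simp: crossing_chirality_def)
  have height: "c * (\<xi> \<bullet> cross3 ?e ?e') = (p i - p j) \<bullet> cross3 ?e ?e'"
    if mem: "x \<in> segment n p i" "y \<in> segment n p j" and diff: "x - y = c *\<^sub>R \<xi>" for x y c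
  proof -
    obtain s t where "x = p i + s *\<^sub>R ?e" "y = p j + t *\<^sub>R ?e'"
      using mem unfolding in_segment_edge by blast
    then have "(x - y) \<bullet> cross3 ?e ?e' = (p i - p j) \<bullet> cross3 ?e ?e'"
      by (simp add: inner_diff_left inner_add_left dot_cross_self)
    then show ?thesis by (simp add: diff)
  qed
  have "c = c'"
    using height[OF xy] height[OF xy'] chi by (metis mult_cancel_right mult_zero_right)
  obtain s t s' t' where st: "x = p i + s *\<^sub>R ?e" "y = p j + t *\<^sub>R ?e'" "x' = p i + s' *\<^sub>R ?e" "y' = p j + t' *\<^sub>R ?e'"
    using xy xy' by (auto simp: in_segment_edge)
  have "cross3 ?e ?e' \<noteq> 0" using chi by auto
  moreover have "s *\<^sub>R ?e + (- t) *\<^sub>R ?e' = s' *\<^sub>R ?e + (- t') *\<^sub>R ?e'"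
  proof -
    have "s *\<^sub>R ?e + (- t) *\<^sub>R ?e' = (x - y) - (p i - p j)" "s' *\<^sub>R ?e + (- t') *\<^sub>R ?e' = (x' - y') - (p i - p j)"
      by (simp_all add: st)
    then show ?thesis by (simp only: xy(3) xy'(3) \<open>c = c'\<close>)
  qed
  ultimately have "s = s'" using coordinates_unique by blast
  then show ?thesis by (simp add: st)
qed

text \<open>
  A double point determines the segments of its upper and its lower strand. By transversality and
  \<open>skew_crossing_unique\<close>, this is a bijection onto the pairs of segments that contribute to
  \<open>signed_crossings\<close>.
\<close>

lemma tait_number_eq_signed_crossings:
  assumes dec: "decomposition K n p" and good: "\<xi> \<in> good_directions K n p"
  shows "of_int (tait_number K n p \<xi>) = signed_crossings n p \<xi>"
proof -
  have \<xi>: "norm \<xi> = 1" and gp: "good_projection K n p \<xi>" using good by (auto simp: good_directions_def)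
  define seg where "seg x = (THE i. i < n \<and> x \<in> segment n p i)" for x
  define strands where "strands v = (seg (upper_point K \<xi> v), seg (lower_point K \<xi> v))" for v
  define P where "P = {(i, j) \<in> {..<n} \<times> {..<n}. lies_over \<xi> (segment n p i) (segment n p j) \<and>
      crossing_chirality n p i j \<noteq> 0}"
  let ?\<chi> = "\<lambda>(i, j). crossing_chirality n p i j"
  have K: "z \<in> K \<longleftrightarrow> (\<exists>i<n. z \<in> segment n p i)" for z using dec by (auto simp: decomposition_def)
  have strands: "strands (orth_proj \<xi> x) = (i, j)"
    if "i < n" "j < n" "x \<in> segment n p i" "y \<in> segment n p j" "x - y = c *\<^sub>R \<xi>" "0 < c" for x y c i j
  proof -
    have "x \<in> K" "y \<in> K" using that K by blast+
    note crossing = good_crossing[OF \<xi> gp this that(5,6)]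
    show ?thesis
      using interior_point_segment_unique[OF dec crossing(1) that(1,3)]
        interior_point_segment_unique[OF dec crossing(2) that(2,4)]
      by (simp add: strands_def seg_def crossing(4,5))
  qed
  have data: "\<exists>x y c i j. i < n \<and> j < n \<and> x \<in> segment n p i \<and> y \<in> segment n p j \<and>
      x - y = c *\<^sub>R \<xi> \<and> 0 < c \<and> v = orth_proj \<xi> x" if "v \<in> double_points K \<xi>" for v
    using double_point_strands[OF \<xi> that] K by metis
  have bij: "bij_betw strands (double_points K \<xi>) P"
    unfolding bij_betw_def
  proof
    show "inj_on strands (double_points K \<xi>)"
    proof
      fix v v' assume vv: "v \<in> double_points K \<xi>" "v' \<in> double_points K \<xi>" "strands v = strands v'"
      obtain x y c i j where 1: "i < n" "j < n" "x \<in> segment n p i" "y \<in> segment n p j"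
          "x - y = c *\<^sub>R \<xi>" "0 < c" "v = orth_proj \<xi> x" using data[OF vv(1)] by blast
      obtain x' y' c' i' j' where 2: "i' < n" "j' < n" "x' \<in> segment n p i'" "y' \<in> segment n p j'"
          "x' - y' = c' *\<^sub>R \<xi>" "0 < c'" "v' = orth_proj \<xi> x'" using data[OF vv(2)] by blast
      have "i' = i" "j' = j" using strands[OF 1(1-6)] strands[OF 2(1-6)] vv(3) 1(7) 2(7) by auto
      then have "x = x'"
        using skew_crossing_unique[OF crossing_sign_eq_chirality(2)[OF dec \<xi> gp 1(1-6)] 1(3-5), of x' y' c'] 2(3-5) by simp
      then show "v = v'" by (simp add: 1(7) 2(7))
    qed
    show "strands ` double_points K \<xi> = P"
    proof (intro equalityI subsetI)
      fix q assume "q \<in> strands ` double_points K \<xi>"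
      then obtain x y c i j where 1: "i < n" "j < n" "x \<in> segment n p i" "y \<in> segment n p j"
          "x - y = c *\<^sub>R \<xi>" "0 < c" "q = strands (orth_proj \<xi> x)" using data by blast
      have "lies_over \<xi> (segment n p i) (segment n p j)"
        using 1(3-6) unfolding lies_over_def ray_def by blast
      then show "q \<in> P"
        using 1(1,2) crossing_sign_eq_chirality(2)[OF dec \<xi> gp 1(1-6)]
        unfolding 1(7) strands[OF 1(1-6)] by (simp add: P_def)
    next
      fix q assume "q \<in> P"
      then obtain i j where ij: "q = (i, j)" "i < n" "j < n" "lies_over \<xi> (segment n p i) (segment n p j)"
        by (auto simp: P_def)
      then obtain x y c where xy: "x \<in> segment n p i" "y \<in> segment n p j" "x - y = c *\<^sub>R \<xi>" "0 < c"
        by (auto simp: lies_over_def ray_def)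
      have "x \<in> K" "y \<in> K" using xy ij K by blast+
      then have "orth_proj \<xi> x \<in> double_points K \<xi>" using good_crossing(3)[OF \<xi> gp] xy(3,4) by blast
      then show "q \<in> strands ` double_points K \<xi>"
        using strands[OF ij(2,3) xy] ij(1) by (metis imageI)
    qed
  qed
  have "signed_crossings n p \<xi> = (\<Sum>q\<in>{..<n} \<times> {..<n}.
      ?\<chi> q * of_bool (lies_over \<xi> (segment n p (fst q)) (segment n p (snd q))))"
    unfolding signed_crossings_def sum.cartesian_product case_prod_unfold ..
  also have "\<dots> = (\<Sum>q\<in>P. ?\<chi> q)"
    by (rule sum.mono_neutral_cong_right) (auto simp: P_def)
  also have "\<dots> = (\<Sum>v\<in>double_points K \<xi>. ?\<chi> (strands v))"
    by (rule sum.reindex_bij_betw[OF bij, symmetric])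
  also have "\<dots> = (\<Sum>v\<in>double_points K \<xi>. of_int (crossing_sign K n p \<xi> v))"
  proof (rule sum.cong[OF refl])
    fix v assume "v \<in> double_points K \<xi>"
    then obtain x y c i j where 1: "i < n" "j < n" "x \<in> segment n p i" "y \<in> segment n p j"
          "x - y = c *\<^sub>R \<xi>" "0 < c" "v = orth_proj \<xi> x" using data by blast
    show "?\<chi> (strands v) = of_int (crossing_sign K n p \<xi> v)"
      unfolding 1(7) strands[OF 1(1-6)] using crossing_sign_eq_chirality(1)[OF dec \<xi> gp 1(1-6)] by simp
  qed
  finally show ?thesis by (simp add: tait_number_def)
qed

section \<open>Distinctness of the vertices\<close>

text \<open>
  The line through two points separates the rest of the circle into two arcs; the unit normal
  vectors of the line show that neither is empty.
\<close>

lemma circle_minus_two_points_disconnected: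
  fixes a b :: "real^2"
  assumes ab: "a \<in> sphere 0 1" "b \<in> sphere 0 1" "a \<noteq> b"
  shows "\<not> connected (sphere 0 1 - {a, b})"
proof
  assume conn: "connected (sphere 0 1 - {a, b})"
  \<comment> \<open>A normal vector of the line through \<open>a\<close> and \<open>b\<close>.\<close>
  define v :: "real^2" where "v = vector [a$2 - b$2, b$1 - a$1]"
  have v: "v$1 = a$2 - b$2" "v$2 = b$1 - a$1" by (simp_all add: v_def)
  have dot: "v \<bullet> x = (a$2 - b$2) * x$1 + (b$1 - a$1) * x$2" for x
    by (simp add: inner_vec_def sum_2 v)
  have circle: "x \<in> sphere 0 1 \<longleftrightarrow> (x$1)\<^sup>2 + (x$2)\<^sup>2 = 1" for x :: "real^2"
    by (simp add: norm_vec_def L2_set_def sum_2)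
  have nz: "v \<noteq> 0" using ab(3) by (auto simp: vec_eq_iff forall_2 v)
  have same: "v \<bullet> b = v \<bullet> a" by (simp add: dot algebra_simps)
  have on_line: "x = a \<or> x = b" if "x \<in> sphere 0 1" "v \<bullet> x = v \<bullet> a" for x
  proof -
    have line: "(a$2 - b$2) * (x$1 - a$1) = (a$1 - b$1) * (x$2 - a$2)"
      using that(2) by (simp add: dot algebra_simps)
    obtain r where r: "x$1 = a$1 + r * (b$1 - a$1)" "x$2 = a$2 + r * (b$2 - a$2)"
    proof (cases "b$1 = a$1")
      case True
      then have "b$2 \<noteq> a$2" using ab(3) by (auto simp: vec_eq_iff forall_2)
      then show ?thesis
        using that[of "(x$2 - a$2) / (b$2 - a$2)"] line True by auto
    next
      case False
      then show ?thesis
        using that[of "(x$1 - a$1) / (b$1 - a$1)"] line by (auto simp: field_simps)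
    qed
    have "r * (r - 1) * ((b$1 - a$1)\<^sup>2 + (b$2 - a$2)\<^sup>2) = 0"
      using that(1) ab(1,2) unfolding circle r by algebra
    moreover have "(b$1 - a$1)\<^sup>2 + (b$2 - a$2)\<^sup>2 \<noteq> 0"
      using ab(3) by (auto simp: vec_eq_iff forall_2)
    ultimately have "r = 0 \<or> r = 1" by (metis mult_eq_0_iff eq_iff_diff_eq_0)
    then show ?thesis using r by (auto simp: vec_eq_iff forall_2)
  qed
  \<comment> \<open>Otherwise the line would be tangent to the circle and \<open>a = b\<close>.\<close>
  have pole: "v \<bullet> a < norm v" "- norm v < v \<bullet> a"
  proof -
    have norm: "norm a = 1" "norm b = 1" using ab by simp_all
    have "v \<bullet> a \<noteq> norm v"
    proof
      assume "v \<bullet> a = norm v"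
      then have "norm v *\<^sub>R a = v" "norm v *\<^sub>R b = v"
        using norm_cauchy_schwarz_eq[of v a] norm_cauchy_schwarz_eq[of v b] same norm by simp_all
      then show False using ab(3) nz by (metis norm_eq_zero scaleR_cancel_left)
    qed
    moreover have "v \<bullet> (- a) \<noteq> norm v"
    proof
      assume "v \<bullet> (- a) = norm v"
      then have "norm v *\<^sub>R (- a) = v" "norm v *\<^sub>R (- b) = v"
        using norm_cauchy_schwarz_eq[of v "- a"] norm_cauchy_schwarz_eq[of v "- b"] same norm by simp_all
      then show False using ab(3) nz by (metis norm_eq_zero scaleR_cancel_left neg_equal_iff_equal)
    qed
    ultimately show "v \<bullet> a < norm v" "- norm v < v \<bullet> a"
      using Cauchy_Schwarz_ineq2[of v a] norm by auto
  qed
  have "norm (sgn v) = 1" using nz by (simp add: norm_sgn)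
  have "v \<bullet> sgn v = norm v" by (simp add: sgn_div_norm dot_square_norm power2_eq_square nz)
  then have poles: "sgn v \<in> sphere 0 1 - {a, b}" "- sgn v \<in> sphere 0 1 - {a, b}"
    using pole same \<open>norm (sgn v) = 1\<close> by auto
  have "sgn v \<in> {x. v \<bullet> a < v \<bullet> x}" "- sgn v \<in> {x. v \<bullet> x < v \<bullet> a}"
    using pole \<open>v \<bullet> sgn v = norm v\<close> by auto
  moreover have "open {x. v \<bullet> a < v \<bullet> x}" "open {x. v \<bullet> x < v \<bullet> a}"
    by (auto intro!: open_Collect_less continuous_intros)
  moreover have "sphere 0 1 - {a, b} \<subseteq> {x. v \<bullet> a < v \<bullet> x} \<union> {x. v \<bullet> x < v \<bullet> a}"
    using on_line by fastforce
  moreover have "{x. v \<bullet> a < v \<bullet> x} \<inter> {x. v \<bullet> x < v \<bullet> a} \<inter> (sphere 0 1 - {a, b}) = {}"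
    by auto
  ultimately show False
    using connectedD[OF conn, of "{x. v \<bullet> a < v \<bullet> x}" "{x. v \<bullet> x < v \<bullet> a}"] poles by blast
qed

lemma circle_not_disconnected_by_two_points:
  assumes K: "K homeomorphic sphere (0 :: real^2) 1" and "a \<in> K" "b \<in> K" "a \<noteq> b"
  shows "\<not> connected (K - {a, b})"
proof
  assume "connected (K - {a, b})"
  obtain h g where h: "homeomorphism K (sphere (0 :: real^2) 1) h g"
    using K unfolding homeomorphic_def by blast
  then have "continuous_on (K - {a, b}) h" "inj_on h K" "h ` K = sphere 0 1"
    by (auto simp: homeomorphism_def intro: continuous_on_subset inj_on_inverseI)
  then have "connected (h ` (K - {a, b}))" "h ` (K - {a, b}) = h ` K - h ` {a, b}" "h a \<noteq> h b"
    using \<open>connected (K - {a, b})\<close> assms(2-4)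
    by (auto intro: connected_continuous_image inj_on_image_set_diff simp: inj_on_eq_iff)
  moreover have "h a \<in> sphere 0 1" "h b \<in> sphere 0 1"
    using \<open>h ` K = sphere 0 1\<close> assms(2,3) by blast+
  ultimately show False using circle_minus_two_points_disconnected \<open>h ` K = sphere 0 1\<close> by simp
qed

text \<open>
  If \<open>p i = p j\<close>, then \<open>K\<close> consists of two closed walks through this point, one with the segment \<open>i\<close>
  and one with the segment \<open>j\<close>. Removing an inner point of one segment from each of them leaves
  both walks connected, so that \<open>K\<close> without these two points is connected; but a circle minus two points is
  not.
\<close>

lemma knot_vertices_distinct:
  assumes knot: "PL_knot K" and dec: "decomposition K n p"
  shows "inj_on p {..<n}"
proof (rule linorder_inj_onI)
  fix i j assume ij: "i < j" "i \<in> {..<n}" "j \<in> {..<n}"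
  show "p i \<noteq> p j"
  proof
    assume closed: "p i = p j"
    \<comment> \<open>The midpoints are the points to be removed.\<close>
    define m where "m k = p k + (1/2) *\<^sub>R edge n p k" for k
    define X where "X = K - {m i, m j}"
    let ?R = "connected_component X (p i)"
    have edge0: "edge n p k \<noteq> 0" if "k < n" for k
      using dec that by (auto simp: decomposition_def edge_def)
    have next_vertex: "p (Suc k mod n) = p k + edge n p k" for k by (simp add: edge_def)
    have m: "m k \<in> segment n p k" for k
      unfolding m_def in_segment_edge by (rule bexI[of _ "1/2"]) auto
    have m_only: "l = k" if "k < n" "l < n" "m k \<in> segment n p l" for k l
    proof (rule ccontr)
      assume "l \<noteq> k"
      then have "m k \<in> segment_ends n p k"
        using dec that m by (fastforce simp: decomposition_def)
      moreover have "m k \<noteq> p k" "m k \<noteq> p (Suc k mod n)"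
        using edge0[OF that(1)] scaleR_cancel_right[of "1/2" "edge n p k" 1] by (simp_all add: m_def next_vertex)
      ultimately show False by (simp add: segment_ends_def)
    qed
    have sub: "segment n p k - {m k} \<subseteq> X" if "k < n" for k
      using dec m_only[of i k] m_only[of j k] that ij by (auto simp: X_def decomposition_def)
    have sub': "segment n p k \<subseteq> X" if "k < n" "k \<noteq> i" "k \<noteq> j" for k
      using dec m_only[of i k] m_only[of j k] that ij by (auto simp: X_def decomposition_def)
    have join: "connected_component X a b" if "closed_segment a b \<subseteq> X" for a b
      using that by (auto simp: connected_component_def intro!: exI[of _ "closed_segment a b"])
    have pull_back: "?R (p k)" if "k < n" "k \<noteq> i" "k \<noteq> j" "?R (p (Suc k mod n))" for k
      using connected_component_trans[OF that(4) connected_component_sym[OF join]] sub'[OF that(1-3)]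
      by (simp add: segment_def)
    have "p i \<in> segment n p i" by (simp add: segment_def)
    moreover have "p i \<noteq> m i" using edge0 ij by (simp add: m_def)
    ultimately have "p i \<in> X" using sub[of i] ij by auto
    then have start: "?R (p i)" by (rule connected_component_refl)
    have low: "?R (p k)" if "k \<le> i" for k
      using that
    proof (induction rule: inc_induct)
      case (step l)
      then show ?case using ij pull_back[of l] by simp
    qed (rule start)
    have middle: "?R (p k)" if "k \<le> j" "i < k" for k
      using that
    proof (induction rule: inc_induct)
      case (step l)
      then show ?case using ij pull_back[of l] by simp
    qed (use start closed in simp)
    \<comment> \<open>With \<open>k = n\<close> for the vertex \<open>0\<close>, where the walk closes up.\<close>
    have high: "?R (p (k mod n))" if "k \<le> n" "j < k" for k
      using that
    proof (induction rule: inc_induct)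
      case (step l)
      then show ?case using ij pull_back[of l] by simp
    qed (use low in simp)
    have vertex: "?R (p k)" if "k < n" for k
    proof -
      consider "k \<le> i" | "k \<le> j" "i < k" | "j < k" by linarith
      then show ?thesis using low[of k] middle[of k] high[of k] that by cases simp_all
    qed
    have all: "?R z" if z: "z \<in> X" for z
    proof -
      obtain k where k: "k < n" "z \<in> segment n p k" using z dec by (auto simp: X_def decomposition_def)
      then obtain s where s: "s \<in> {0..1}" "z = p k + s *\<^sub>R edge n p k" by (auto simp: in_segment_edge)
    have lt: "Suc k mod n < n" using k(1) by simp
      have half: "\<exists>l<n. closed_segment (p l) z \<subseteq> X"
      proof (cases "k = i \<or> k = j")
        case False
        have "closed_segment (p k) z \<subseteq> segment n p k"
          using k(2) by (simp add: segment_def subset_closed_segment)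
        then have "closed_segment (p k) z \<subseteq> X"
          using sub'[OF k(1)] False by blast
        then show ?thesis using k(1) by blast
      next
        case True
        then have "z \<noteq> m k" using z by (auto simp: X_def)
        then have "s \<noteq> 1/2" using s(2) by (auto simp: m_def)
        then consider "s < 1/2" | "1/2 < s" by linarith
        then show ?thesis
        proof cases
          case 1
          have "m k \<notin> closed_segment (p k) z"
          proof
            assume "m k \<in> closed_segment (p k) z"
            then obtain r where r: "0 \<le> r" "r \<le> 1" "m k = (1 - r) *\<^sub>R p k + r *\<^sub>R z"
              by (auto simp: in_segment)
            then have "(1/2 - r * s) *\<^sub>R edge n p k = 0" by (simp add: m_def s(2) algebra_simps)
            then have "r * s = 1/2" using edge0[OF k(1)] by simp
            moreover have "r * s \<le> 1 * s" using r s by (intro mult_right_mono) auto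
            ultimately show False using 1 by simp
          qed
          moreover have "closed_segment (p k) z \<subseteq> segment n p k"
            using k(2) by (simp add: segment_def subset_closed_segment)
          ultimately show ?thesis using sub[OF k(1)] k(1) by blast
        next
          case 2
          have "m k \<notin> closed_segment (p (Suc k mod n)) z"
          proof
            assume "m k \<in> closed_segment (p (Suc k mod n)) z"
            then obtain r where r: "0 \<le> r" "r \<le> 1" "m k = (1 - r) *\<^sub>R p (Suc k mod n) + r *\<^sub>R z"
              by (auto simp: in_segment)
            moreover have "(1 - r) *\<^sub>R p (Suc k mod n) + r *\<^sub>R z = p k + (1 - r * (1 - s)) *\<^sub>R edge n p k"
              by (simp add: s(2) next_vertex algebra_simps)
            ultimately have "(1/2) *\<^sub>R edge n p k = (1 - r * (1 - s)) *\<^sub>R edge n p k"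
              by (simp add: m_def)
            then have "r * (1 - s) = 1/2" using edge0[OF k(1)] by (simp only: scaleR_cancel_right) simp
            moreover have "r * (1 - s) \<le> 1 * (1 - s)" using r s by (intro mult_right_mono) auto
            ultimately show False using 2 by simp
          qed
          moreover have "closed_segment (p (Suc k mod n)) z \<subseteq> segment n p k"
            using k(2) by (simp add: segment_def subset_closed_segment)
          ultimately show ?thesis using sub[OF k(1)] lt by blast
        qed
      qed
      then obtain l where "l < n" "closed_segment (p l) z \<subseteq> X" by blast
      then show ?thesis
        using connected_component_trans[OF vertex join] by blast
    qed
    have "connected X"
      unfolding connected_iff_connected_component
    proof (intro ballI)
      fix x y assume "x \<in> X" "y \<in> X"
      then show "connected_component X x y"
        using connected_component_trans[OF connected_component_sym[OF all] all] by blast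
    qed
    moreover have "m k \<in> K" if "k < n" for k
      using m[of k] dec that unfolding decomposition_def by blast
    then have "m i \<in> K" "m j \<in> K" using ij by simp_all
    moreover have "m i \<noteq> m j" using m_only[of i j] m[of j] ij by auto
    ultimately show False
      using circle_not_disconnected_by_two_points[of K "m i" "m j"] knot by (simp add: PL_knot_def X_def)
  qed
qed auto

theorem proposition1:
  fixes K :: "(real^3) set" and n :: nat and p :: "nat \<Rightarrow> real^3" and \<xi> \<xi>' :: "real^3"
  assumes "PL_knot K"
    and "decomposition K n p"
    and "\<xi> \<in> good_directions K n p"
    and "\<xi>' \<in> good_directions K n p"
    and "connected_component (sphere 0 1 - indicatrix n p) \<xi> \<xi>'"
  shows "tait_number K n p \<xi> = tait_number K n p \<xi>'"
proof -
  have free: "vertex_free K n p \<xi>" "vertex_free K n p \<xi>'"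
    using assms(3,4) good_projection_vertex_free[OF assms(2)] by (simp_all add: good_directions_def)
  have "real_of_int (tait_number K n p \<xi>) = real_of_int (tait_number K n p \<xi>')"
    using signed_crossings_constant_on_component[OF assms(2) knot_vertices_distinct[OF assms(1,2)] assms(5) free]
      tait_number_eq_signed_crossings[OF assms(2)] assms(3,4) by simp
  then show ?thesis by simp
qed

end
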